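(* Let $f\colon X\to X$ be an aperiodic interval exchange transformation, $X=[0,b)$. Then the critical set $$X_{\psi=0}=\{\,t\in(0,b)\mid \psi(t)=0\,\}$$ is meager and has Lebesgue measure $0$.
   Context: An interval exchange transformation (IET) is a pair $(X,f)$ where $X=[0,b)\subset\mathbb{R}$ is a bounded interval ($b>0$) and $f\colon X\to X$ is a right continuous bijection with a finite set $D$ of discontinuities such that $f'(x)=1$ for all $x\in X\setminus D$. It is aperiodic if it has no periodic points. Write $D=\{d_1<\dots<d_{r-1}\}$, $r\ge2$, $d_0=0$, $d_r=b$ (so $0,b\notin D$), and $D_0=D\cup\{0,b\}=\{d_k\}_{k=0}^r$. For $x\in X$ and $n\ge1$ set $$\rho(x)=\min_{0\le k\le r}|x-d_k|,\qquad \rho_n(x)=\min_{-n\le k\le n-1}\rho(f^k(x)),$$ $$\Delta_n(x)=\min_{\substack{|p|,|q|\le n\\ p\ne q}}|f^p(x)-f^q(x)|,\qquad \rho'_n(x)=\min\big(\rho_n(x),\tfrac12\Delta_n(x)\big),$$ ($p,q$ integers) and $\psi(x)=\limsup_{n\to\infty} n\,\rho'_n(x)$. *)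

theory Defs
  imports "HOL-Analysis.Analysis"
begin

(* Continuity is taken relative to [0,b), so 0 is judged from the right only, and values
   of f outside [0,b) play no role. *)
definition discont :: "real \<Rightarrow> (real \<Rightarrow> real) \<Rightarrow> real set" where
  "discont b f = {x \<in> {0..<b}. \<not> continuous (at x within {0..<b}) f}"

(* The derivative at 0 is likewise one-sided. *)
definition is_iet :: "real \<Rightarrow> (real \<Rightarrow> real) \<Rightarrow> bool" where
  "is_iet b f \<longleftrightarrow>
     b > 0 \<and>
     bij_betw f {0..<b} {0..<b} \<and>
     (\<forall>x\<in>{0..<b}. continuous (at_right x) f) \<and>
     finite (discont b f) \<and>
     (\<forall>x\<in>{0..<b} - discont b f. (f has_real_derivative 1) (at x within {0..<b}))"

definition aperiodic :: "real \<Rightarrow> (real \<Rightarrow> real) \<Rightarrow> bool" where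
  "aperiodic b f \<longleftrightarrow> (\<forall>x\<in>{0..<b}. \<forall>n\<ge>1. (f ^^ n) x \<noteq> x)"

definition iet_pow :: "real \<Rightarrow> (real \<Rightarrow> real) \<Rightarrow> int \<Rightarrow> real \<Rightarrow> real" where
  "iet_pow b f k =
     (if k \<ge> 0 then f ^^ nat k else (inv_into {0..<b} f) ^^ nat (- k))"

definition rho :: "real \<Rightarrow> (real \<Rightarrow> real) \<Rightarrow> real \<Rightarrow> real" where
  "rho b f x = (MIN d\<in>discont b f \<union> {0, b}. \<bar>x - d\<bar>)"

(* The quantities indexed by n below are meaningful for n \<ge> 1 only (at n = 0 a minimum
   over the empty set occurs); psi does not depend on their values at n = 0. *)
definition rho_n :: "real \<Rightarrow> (real \<Rightarrow> real) \<Rightarrow> nat \<Rightarrow> real \<Rightarrow> real" where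
  "rho_n b f n x = (MIN k\<in>{- int n..int n - 1}. rho b f (iet_pow b f k x))"

definition Delta_n :: "real \<Rightarrow> (real \<Rightarrow> real) \<Rightarrow> nat \<Rightarrow> real \<Rightarrow> real" where
  "Delta_n b f n x =
     Min {\<bar>iet_pow b f p x - iet_pow b f q x\<bar> | p q.
            \<bar>p\<bar> \<le> int n \<and> \<bar>q\<bar> \<le> int n \<and> p \<noteq> q}"

definition rho'_n :: "real \<Rightarrow> (real \<Rightarrow> real) \<Rightarrow> nat \<Rightarrow> real \<Rightarrow> real" where
  "rho'_n b f n x = min (rho_n b f n x) (1 / 2 * Delta_n b f n x)"

definition psi :: "real \<Rightarrow> (real \<Rightarrow> real) \<Rightarrow> real \<Rightarrow> ereal" where
  "psi b f x = limsup (\<lambda>n. ereal (real n * rho'_n b f n x))"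

definition critical_set :: "real \<Rightarrow> (real \<Rightarrow> real) \<Rightarrow> real set" where
  "critical_set b f = {t \<in> {0<..<b}. psi b f t = 0}"

definition nowhere_dense :: "'a::topological_space set \<Rightarrow> bool" where
  "nowhere_dense S \<longleftrightarrow> interior (closure S) = {}"

definition meager :: "'a::topological_space set \<Rightarrow> bool" where
  "meager S \<longleftrightarrow> (\<exists>\<C>. countable \<C> \<and> (\<forall>N\<in>\<C>. nowhere_dense N) \<and> S = \<Union>\<C>)"

end

theory Submission
  imports Defs
begin

text \<open>
The theorem rests on Rokhlin towers: a base interval $[p, p+w)$ whose first $n$ images under $f$ are
pairwise disjoint translates of it. A point of such a tower that stays away from the ends of its level
by $\eta w$, and from the bottom and the top of the tower by $m \approx \eta n$ levels, has $2m$
consecutive iterates that avoid the discontinuities by $\eta w$ and differ pairwise by at least $w$.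
Hence $\rho'_m \ge \eta w$ at this point, and $m \rho'_m$ is at least about $\eta^2 n w$
(\<open>rho'_n_in_tower\<close>).

\<^bold>\<open>Covering by few towers.\<close> Aperiodicity forbids an interval that all powers of $f$ translate: two of
its images would overlap, and some power of $f$ would then push points steadily in one direction, out
of the bounded space (\<open>not_translates_forever\<close>). So every orbit comes arbitrarily close to a break point
from the left, forwards and backwards. Inducing on the left neighbourhoods of length $h$ of the break
points and of $b$ splits the space into towers of width at most $h$. Their number is bounded in terms of
the number of break points only, independently of $h$ (\<open>few_towers_cover\<close>).

\<^bold>\<open>Measure.\<close> Since the number of towers is bounded, those of area $nw < \beta$ have small total measure;
in the others all but a proportion $4\eta$ of the points are good, with $m$ tending to infinity as
$h \to 0$. Letting $h \to 0$ shows that for every $s > 0$ there is a $c > 0$ such that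
$m \rho'_m \ge c$ for infinitely many $m$ outside a set of measure at most $s$
(\<open>recurrently_good_up_to_small_measure\<close>). Such points have $\psi \ge c$, so the critical set is null.

\<^bold>\<open>Category.\<close> Here one $c$ must serve a dense set of points. Up to halving $c$, the property above is
constant along orbits, so it suffices that the saturation of every open interval has measure bounded
below. This holds because a right open invariant set is determined by the break points that it contains
a left neighbourhood of: there are only finitely many such sets
(\<open>invariant_contains_long_interval\<close>). As $\rho'_n$ is locally
Lipschitz where it is positive, the sets on which $n \rho'_n$ stays below $c/2$ from some index on
are nowhere dense, and they cover the critical set.
\<close>

section \<open>Distances along orbits and measures of interval unions\<close>

text \<open>
The lower bounds on $\rho'_n$ below are all proved through this form, which replaces the nested minima by
the individual distances; conversely, applied to $r = \rho'_n$ it releases all these distances at once.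
\<close>

lemma le_rho'_n_iff:
  assumes "finite (discont b f)" "1 \<le> n"
  shows "r \<le> rho'_n b f n x \<longleftrightarrow>
    (\<forall>k\<in>{- int n..int n - 1}. \<forall>d\<in>discont b f \<union> {0, b}. r \<le> \<bar>iet_pow b f k x - d\<bar>) \<and>
    (\<forall>p q. \<bar>p\<bar> \<le> int n \<and> \<bar>q\<bar> \<le> int n \<and> p \<noteq> q \<longrightarrow> 2 * r \<le> \<bar>iet_pow b f p x - iet_pow b f q x\<bar>)"
proof -
  define I where "I = {(p, q). \<bar>p\<bar> \<le> int n \<and> \<bar>q\<bar> \<le> int n \<and> p \<noteq> q}"
  define \<delta> where "\<delta> = (\<lambda>(p, q). \<bar>iet_pow b f p x - iet_pow b f q x\<bar>)"
  have "I \<subseteq> {- int n..int n} \<times> {- int n..int n}" by (auto simp: I_def)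
  then have fin: "finite I" by (rule finite_subset) simp
  have "(0, 1) \<in> I" using assms(2) by (simp add: I_def)
  then have ne: "I \<noteq> {}" by blast
  have "{\<bar>iet_pow b f p x - iet_pow b f q x\<bar> | p q. \<bar>p\<bar> \<le> int n \<and> \<bar>q\<bar> \<le> int n \<and> p \<noteq> q} = \<delta> ` I"
    by (auto simp: I_def \<delta>_def)
  then have Delta: "r \<le> 1 / 2 * Delta_n b f n x \<longleftrightarrow> (\<forall>i\<in>I. 2 * r \<le> \<delta> i)"
    using Min_ge_iff[of "\<delta> ` I" "2 * r"] fin ne unfolding Delta_n_def by auto
  have rho: "r \<le> rho b f y \<longleftrightarrow> (\<forall>d\<in>discont b f \<union> {0, b}. r \<le> \<bar>y - d\<bar>)" for y
    unfolding rho_def using assms(1) by (subst Min_ge_iff) auto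
  have "{- int n..int n - 1} \<noteq> {}" using assms(2) by auto
  then have "r \<le> rho_n b f n x \<longleftrightarrow> (\<forall>k\<in>{- int n..int n - 1}. r \<le> rho b f (iet_pow b f k x))"
    unfolding rho_n_def by (subst Min_ge_iff) auto
  then show ?thesis
    unfolding rho'_n_def min.bounded_iff Delta rho by (auto simp: I_def \<delta>_def)
qed

lemma interval_union_lmeasurable:
  fixes a :: "'i \<Rightarrow> real" and w :: real
  assumes "finite I" "0 \<le> w"
  shows "(\<Union>i\<in>I. {a i..<a i + w}) \<in> lmeasurable"
    and "measure lebesgue (\<Union>i\<in>I. {a i..<a i + w}) \<le> card I * w"
proof -
  have int: "{a i..<a i + w} \<in> lmeasurable" for i
    by (rule bounded_set_imp_lmeasurable) (auto intro: bounded_subset[OF bounded_closed_interval])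
  show "(\<Union>i\<in>I. {a i..<a i + w}) \<in> lmeasurable"
    using int assms(1) by (intro fmeasurable.finite_UN) auto
  have "measure lebesgue (\<Union>i\<in>I. {a i..<a i + w}) \<le> (\<Sum>i\<in>I. measure lebesgue {a i..<a i + w})"
    using int assms(1) by (intro measure_UNION_le) auto
  also have "\<dots> = card I * w" using assms(2) by simp
  finally show "measure lebesgue (\<Union>i\<in>I. {a i..<a i + w}) \<le> card I * w" .
qed

text \<open>
Used where one length has to be small enough for all break points, or for all classes of invariant sets,
simultaneously.
\<close>

lemma uniform_positive_bound:
  fixes P :: "'i \<Rightarrow> real \<Rightarrow> bool"
  assumes "finite A" "\<And>a. a \<in> A \<Longrightarrow> \<exists>\<delta>>0. P a \<delta>"
    and "\<And>a \<delta> \<delta>'. P a \<delta> \<Longrightarrow> 0 < \<delta>' \<Longrightarrow> \<delta>' \<le> \<delta> \<Longrightarrow> P a \<delta>'"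
  shows "\<exists>\<delta>>0. \<forall>a\<in>A. P a \<delta>"
  using assms(1,2)
proof (induction A rule: finite_induct)
  case empty
  show ?case by (intro exI[of _ 1]) simp
next
  case (insert a A)
  obtain \<delta> \<delta>' where "0 < \<delta>" "P a \<delta>" "0 < \<delta>'" "\<forall>a\<in>A. P a \<delta>'"
    using insert.IH insert.prems by (meson insert_iff)
  then show ?case using assms(3) by (intro exI[of _ "min \<delta> \<delta>'"]) auto
qed

section \<open>Invertible piecewise translations\<close>

text \<open>
Break points are a finite set \<open>D\<close> that serves both $f$ and its inverse \<open>g\<close>. It may be larger
than the set of discontinuities. The assumptions pass from $f$ to \<open>g\<close>, so that every
statement about forward orbits also yields the one about backward orbits.
\<close>

locale piecewise_translation =
  fixes b :: real and f g :: "real \<Rightarrow> real" and D :: "real set"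
  assumes finite_D: "finite D"
    and D_subset: "D \<subseteq> {0..<b}"
    and f_in: "x \<in> {0..<b} \<Longrightarrow> f x \<in> {0..<b}"
    and g_in: "x \<in> {0..<b} \<Longrightarrow> g x \<in> {0..<b}"
    and g_f: "x \<in> {0..<b} \<Longrightarrow> g (f x) = x"
    and f_g: "x \<in> {0..<b} \<Longrightarrow> f (g x) = x"
    and f_shift: "0 \<le> u \<Longrightarrow> v \<le> b \<Longrightarrow> {u<..<v} \<inter> D = {} \<Longrightarrow> x \<in> {u..<v} \<Longrightarrow> f x = f u + (x - u)"
    and g_shift: "0 \<le> u \<Longrightarrow> v \<le> b \<Longrightarrow> {u<..<v} \<inter> D = {} \<Longrightarrow> x \<in> {u..<v} \<Longrightarrow> g x = g u + (x - u)"
    and no_period: "x \<in> {0..<b} \<Longrightarrow> 1 \<le> n \<Longrightarrow> (f ^^ n) x \<noteq> x"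
    and b_pos: "0 < b"
begin

lemma f_pow_in: "x \<in> {0..<b} \<Longrightarrow> (f ^^ i) x \<in> {0..<b}"
  by (induction i) (auto dest: f_in simp del: atLeastLessThan_iff)

lemma g_pow_in: "x \<in> {0..<b} \<Longrightarrow> (g ^^ i) x \<in> {0..<b}"
  by (induction i) (auto dest: g_in simp del: atLeastLessThan_iff)

lemma g_pow_f_pow: "x \<in> {0..<b} \<Longrightarrow> (g ^^ i) ((f ^^ i) x) = x"
proof (induction i)
  case (Suc i)
  then show ?case
    using g_f[OF f_pow_in[OF Suc.prems, of i]] by (simp add: funpow_swap1)
qed simp

lemma f_pow_g_pow: "x \<in> {0..<b} \<Longrightarrow> (f ^^ i) ((g ^^ i) x) = x"
proof (induction i)
  case (Suc i)
  then show ?case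
    using f_g[OF g_pow_in[OF Suc.prems, of i]] by (simp add: funpow_swap1)
qed simp

lemma f_pow_inject:
  assumes "x \<in> {0..<b}" "y \<in> {0..<b}" "(f ^^ i) x = (f ^^ i) y"
  shows "x = y"
proof -
  have "x = (g ^^ i) ((f ^^ i) x)" by (rule g_pow_f_pow[OF assms(1), symmetric])
  also have "\<dots> = (g ^^ i) ((f ^^ i) y)" by (simp only: assms(3))
  also have "\<dots> = y" by (rule g_pow_f_pow[OF assms(2)])
  finally show ?thesis .
qed

lemma f_pow_g_pow_diff:
  assumes "x \<in> {0..<b}" "i \<le> k"
  shows "(f ^^ i) ((g ^^ k) x) = (g ^^ (k - i)) x"
proof -
  have "(g ^^ (i + (k - i))) x = (g ^^ i) ((g ^^ (k - i)) x)"
    by (simp only: funpow_add comp_apply)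
  then have "(g ^^ k) x = (g ^^ i) ((g ^^ (k - i)) x)"
    using assms(2) by simp
  then show ?thesis
    by (simp only: f_pow_g_pow[OF g_pow_in[OF assms(1)]])
qed

lemma inverse_piecewise_translation: "piecewise_translation b g f D"
proof
  fix x :: real and n :: nat
  assume x: "x \<in> {0..<b}" and n: "1 \<le> n"
  show "(g ^^ n) x \<noteq> x"
    using f_pow_g_pow[OF x, of n] no_period[OF x n] by auto
qed (fact finite_D D_subset f_in g_in g_f f_g b_pos f_shift g_shift)+

definition translates :: "nat \<Rightarrow> real \<Rightarrow> real \<Rightarrow> bool" where
  "translates i x w \<longleftrightarrow> (\<forall>u. 0 \<le> u \<and> u < w \<longrightarrow> (f ^^ i) (x + u) = (f ^^ i) x + u)"

lemma translatesD: "translates i x w \<Longrightarrow> 0 \<le> u \<Longrightarrow> u < w \<Longrightarrow> (f ^^ i) (x + u) = (f ^^ i) x + u"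
  by (simp add: translates_def)

lemma translates_0: "translates 0 x w"
  by (simp add: translates_def)

lemma translates_image_in:
  assumes "translates i x w" "0 \<le> x" "x + w \<le> b" "0 < w"
  shows "0 \<le> (f ^^ i) x" "(f ^^ i) x + w \<le> b"
proof -
  show "0 \<le> (f ^^ i) x"
    using f_pow_in[of x i] assms by auto
  have lt: "(f ^^ i) x + u < b" if "0 \<le> u" "u < w" for u
    using f_pow_in[of "x + u" i] translatesD[OF assms(1) that] assms that by auto
  show "(f ^^ i) x + w \<le> b"
  proof (rule ccontr)
    assume "\<not> ?thesis"
    then show False
      using lt[of "max 0 (b - (f ^^ i) x)"] assms(4) lt[of 0] by auto
  qed
qed

lemma translates_Suc:
  assumes "translates i x w" "0 \<le> x" "x + w \<le> b"
    and "{(f ^^ i) x<..<(f ^^ i) x + w} \<inter> D = {}"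
  shows "translates (Suc i) x w"
proof (cases "0 < w")
  case True
  note im = translates_image_in[OF assms(1-3) True]
  show ?thesis
    unfolding translates_def
  proof (intro allI impI)
    fix u assume u: "0 \<le> u \<and> u < w"
    then have "(f ^^ Suc i) (x + u) = f ((f ^^ i) x + u)"
      using translatesD[OF assms(1)] by simp
    also have "\<dots> = f ((f ^^ i) x) + u"
      using f_shift[OF im assms(4), of "(f ^^ i) x + u"] u by auto
    finally show "(f ^^ Suc i) (x + u) = (f ^^ Suc i) x + u" by simp
  qed
qed (simp add: translates_def)

lemma translates_add:
  assumes "translates i x w" "translates (k + i) x w" "0 \<le> u" "u < w"
  shows "(f ^^ k) ((f ^^ i) x + u) = (f ^^ k) ((f ^^ i) x) + u"
  using translatesD[OF assms(1,3,4)] translatesD[OF assms(2-4)] by (simp add: funpow_add)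

text \<open>
Pigeonhole: the orbit has only finitely many cells of length $h$ at its disposal.
\<close>

lemma close_iterates:
  assumes x: "x \<in> {0..<b}" and h: "0 < h"
  obtains i j where "i < j" "\<bar>(f ^^ i) x - (f ^^ j) x\<bar> < h"
proof -
  let ?c = "\<lambda>i. \<lfloor>(f ^^ i) x / h\<rfloor>"
  have "range ?c \<subseteq> {0..\<lfloor>b / h\<rfloor>}"
  proof clarify
    fix i
    have "0 \<le> (f ^^ i) x / h" "(f ^^ i) x / h \<le> b / h"
      using f_pow_in[OF x, of i] h by (auto simp: divide_right_mono)
    then show "?c i \<in> {0..\<lfloor>b / h\<rfloor>}" by (simp add: floor_mono)
  qed
  then have "finite (range ?c)"
    by (rule finite_subset) simp
  then have "\<not> inj ?c"
    using finite_imageD[of ?c UNIV] by auto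
  then obtain i j where "i \<noteq> j" "?c i = ?c j"
    by (auto simp: inj_def)
  then obtain i j where ij: "i < j" "?c i = ?c j"
    by (cases i j rule: linorder_cases) metis+
  have "\<bar>(f ^^ i) x / h - (f ^^ j) x / h\<bar> < 1"
    using ij(2) by linarith
  then have "\<bar>(f ^^ i) x - (f ^^ j) x\<bar> < h"
    using h by (simp add: diff_divide_distrib[symmetric] abs_divide)
  with ij(1) show thesis by (rule that)
qed

text \<open>
If all powers of $f$ translated $[x, x+h)$, choose two iterates of $x$ closer than $h$. Then for some
$m \ge 1$ and an iterate $y$, the points $y$ and $f^m(y) = y + \tau$ lie in a common interval
translated by all powers of $f$, so $f^m$ keeps moving $y$ by the same $\tau$. Aperiodicity gives
$\tau \neq 0$, and the orbit leaves the bounded space.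
\<close>

lemma not_translates_forever:
  assumes "0 \<le> x" "0 < h" "x + h \<le> b"
  shows "\<exists>k. \<not> translates k x h"
proof (rule ccontr)
  assume "\<not> ?thesis"
  then have tr: "translates k x h" for k by blast
  have shift: "(f ^^ k) ((f ^^ i) x + u) = (f ^^ k) ((f ^^ i) x) + u" if "0 \<le> u" "u < h" for k i u
    using translates_add[OF tr tr that] .
  have x: "x \<in> {0..<b}" using assms by simp
  obtain i j where ij: "i < j" and close: "\<bar>(f ^^ i) x - (f ^^ j) x\<bar> < h"
    using close_iterates[OF x assms(2)] .
  define m where "m = j - i"
  define y where "y = (f ^^ i) x"
  define \<tau> where "\<tau> = (f ^^ m) y - y"
  have y_in: "y \<in> {0..<b}" unfolding y_def by (rule f_pow_in[OF x])
  have mi: "m + i = j" using ij by (simp add: m_def)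
  have fm_y: "(f ^^ m) y = (f ^^ j) x"
    by (simp add: y_def mi[symmetric] funpow_add)
  have tau_small: "\<bar>\<tau>\<bar> < h" using close unfolding \<tau>_def fm_y by (simp add: y_def)
  have tau_nz: "\<tau> \<noteq> 0"
    using no_period[OF y_in, of m] ij by (simp add: \<tau>_def m_def)
  \<comment> \<open>The right one of y and f^m y lies in the translated interval that starts at the left one.\<close>
  have step: "(f ^^ k) ((f ^^ m) y) = (f ^^ k) y + \<tau>" for k
  proof (cases "0 \<le> \<tau>")
    case True
    then show ?thesis
      using shift[of \<tau> k i] tau_small unfolding y_def[symmetric] by (simp add: \<tau>_def)
  next
    case False
    then show ?thesis
      using shift[of "- \<tau>" k j] tau_small unfolding fm_y[symmetric] by (simp add: \<tau>_def)
  qed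
  have drift: "(f ^^ (l * m)) y = y + real l * \<tau>" for l
  proof (induction l)
    case (Suc l)
    have "(f ^^ (Suc l * m)) y = (f ^^ (l * m)) ((f ^^ m) y)"
      using funpow_add[of "l * m" m f] by (simp add: add.commute)
    then show ?case
      using step[of "l * m"] Suc.IH by (simp add: algebra_simps)
  qed simp
  obtain l :: nat where "b / \<bar>\<tau>\<bar> < real l"
    using reals_Archimedean2 by blast
  then have "b < \<bar>real l * \<tau>\<bar>"
    using tau_nz by (simp add: field_simps abs_mult)
  moreover have "(f ^^ (l * m)) y \<in> {0..<b}" by (rule f_pow_in[OF y_in])
  ultimately show False using drift[of l] y_in by auto
qed

lemma reaches_break_point:
  assumes "0 \<le> x" "0 < h" "x + h \<le> b"
  obtains k d where "\<And>i. i \<le> k \<Longrightarrow> translates i x h"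
    and "d \<in> D" "(f ^^ k) x < d" "d < (f ^^ k) x + h"
proof -
  define k where "k = (LEAST k. \<not> translates k x h)"
  have nk: "\<not> translates k x h"
    unfolding k_def using not_translates_forever[OF assms] by (rule LeastI_ex)
  have before: "translates i x h" if "i < k" for i
    using that not_less_Least unfolding k_def by blast
  have "k \<noteq> 0" using nk translates_0 by metis
  then obtain k' where k': "k = Suc k'" using not0_implies_Suc by blast
  have "{(f ^^ k') x<..<(f ^^ k') x + h} \<inter> D \<noteq> {}"
    using translates_Suc[of k' x h] before[of k'] nk assms k' by auto
  then obtain d where "d \<in> D" "(f ^^ k') x < d" "d < (f ^^ k') x + h" by auto
  with before show thesis using k' by (intro that) auto
qed

section \<open>Covering by few towers\<close>

text \<open>
The set on which the dynamics is induced. Left neighbourhoods suffice because a half-open interval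
whose translation is obstructed has a break point to the right of its left end; the one of $b$ takes care of
points too close to $b$ to be the left end of an interval of length $h$.
\<close>

definition near :: "real \<Rightarrow> real set" where
  "near h = {0..<b} \<inter> (\<Union>d\<in>insert b D. {d - h..<d})"

text \<open>
A half-open interval in $[0, b)$ without a cut in its interior has no break point there either, and lies
either inside or outside \<open>near h\<close>.
\<close>

definition cuts :: "real \<Rightarrow> real set" where
  "cuts h = insert 0 (D \<union> (\<lambda>d. d - h) ` insert b D)"

lemma finite_cuts: "finite (cuts h)"
  by (simp add: cuts_def finite_D)

lemma card_cuts: "card (cuts h) \<le> 2 * card D + 2"
proof -
  have "card ((\<lambda>d. d - h) ` insert b D) \<le> Suc (card D)"
    using card_image_le[of "insert b D" "\<lambda>d. d - h"] by (simp add: card_insert_if finite_D split: if_splits)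
  then have "card (D \<union> (\<lambda>d. d - h) ` insert b D) \<le> 2 * card D + 1"
    using card_Un_le[of D "(\<lambda>d. d - h) ` insert b D"] by linarith
  then show ?thesis
    unfolding cuts_def by (simp add: card_insert_if finite_D)
qed

lemma near_in: "y \<in> near h \<Longrightarrow> y \<in> {0..<b}"
  by (simp add: near_def)

lemma cut_free_in_near:
  assumes "0 \<le> u" "v \<le> b" "{u<..<v} \<inter> cuts h = {}" "z \<in> {u..<v}" "z \<in> near h"
  shows "{u..<v} \<subseteq> near h" "v - u \<le> h"
proof -
  obtain d where d: "d \<in> insert b D" "d - h \<le> z" "z < d"
    using assms(5) by (auto simp: near_def)
  have "d \<notin> {u<..<v}" "d - h \<notin> {u<..<v}"
    using d(1) assms(2,3) by (auto simp: cuts_def)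
  then have "d - h \<le> u" "v \<le> d" using assms(4) d by auto
  then show "{u..<v} \<subseteq> near h" "v - u \<le> h"
    using d(1) assms(1,2) by (fastforce simp: near_def)+
qed

lemma hits_near:
  assumes "x \<in> {0..<b}" "0 < h"
  shows "\<exists>k. (f ^^ k) x \<in> near h"
proof (cases "x + h \<le> b")
  case True
  have "0 \<le> x" using assms(1) by simp
  then obtain k d where "d \<in> D" "(f ^^ k) x < d" "d < (f ^^ k) x + h"
    using reaches_break_point[OF _ assms(2) True] by metis
  then have "(f ^^ k) x \<in> near h"
    using f_pow_in[OF assms(1), of k] by (auto simp: near_def intro!: bexI[of _ d])
  then show ?thesis ..
next
  case False
  then have "(f ^^ 0) x \<in> near h" using assms by (auto simp: near_def)
  then show ?thesis ..
qed

lemma hits_near_backwards: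
  assumes "x \<in> {0..<b}" "0 < h"
  shows "\<exists>k. (g ^^ k) x \<in> near h"
  using piecewise_translation.hits_near[OF inverse_piecewise_translation assms] .

text \<open>
Points of \<open>near h\<close> whose orbit meets a cut before or at their first return; they separate the bases of
the towers.
\<close>

definition marks :: "real \<Rightarrow> real set" where
  "marks h = {y \<in> near h. \<exists>k. (f ^^ k) y \<in> cuts h \<and> (\<forall>i. 0 < i \<and> i < k \<longrightarrow> (f ^^ i) y \<notin> near h)}"

text \<open>
A cut can be met by at most one orbit arriving from \<open>near h\<close>: of two such orbits, run back from the
cut, the longer one would pass through the starting point of the shorter one, which lies in \<open>near h\<close>.
\<close>

lemma first_return_unique:
  assumes "y \<in> near h" "y' \<in> near h" "0 < k" "k \<le> k'" "(f ^^ k) y = (f ^^ k') y'"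
    and "\<forall>i. 0 < i \<and> i < k' \<longrightarrow> (f ^^ i) y' \<notin> near h"
  shows "y = y'"
proof -
  have "(f ^^ (k + (k' - k))) y' = (f ^^ k) ((f ^^ (k' - k)) y')"
    by (simp only: funpow_add comp_apply)
  then have "(f ^^ k) y = (f ^^ k) ((f ^^ (k' - k)) y')"
    using assms(4,5) by simp
  then have y: "y = (f ^^ (k' - k)) y'"
    by (rule f_pow_inject[OF near_in[OF assms(1)] f_pow_in[OF near_in[OF assms(2)]]])
  have "k = k'"
  proof (rule ccontr)
    assume "k \<noteq> k'"
    then have "(f ^^ (k' - k)) y' \<notin> near h" using assms(3,4,6) by simp
    then show False using y assms(1) by simp
  qed
  then show ?thesis using y by simp
qed

text \<open>
A mark is a cut itself, or is recovered by \<open>first_return_unique\<close> from the cut that its orbit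
meets. So there are at most twice as many marks as cuts, whatever $h$ is.
\<close>

lemma marks_finite_card: "finite (marks h) \<and> card (marks h) \<le> 4 * card D + 4"
proof -
  define Q where "Q = {y \<in> near h. \<exists>k>0. (f ^^ k) y \<in> cuts h \<and>
    (\<forall>i. 0 < i \<and> i < k \<longrightarrow> (f ^^ i) y \<notin> near h)}"
  have "\<exists>\<kappa>. \<forall>y\<in>Q. 0 < \<kappa> y \<and> (f ^^ \<kappa> y) y \<in> cuts h \<and>
    (\<forall>i. 0 < i \<and> i < \<kappa> y \<longrightarrow> (f ^^ i) y \<notin> near h)"
    by (rule bchoice) (auto simp: Q_def)
  then obtain \<kappa> where \<kappa>: "0 < \<kappa> y" "(f ^^ \<kappa> y) y \<in> cuts h"
      "\<forall>i. 0 < i \<and> i < \<kappa> y \<longrightarrow> (f ^^ i) y \<notin> near h" if "y \<in> Q" for y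
    by blast
  have Q_near: "y \<in> near h" if "y \<in> Q" for y using that by (simp add: Q_def)
  have inj: "inj_on (\<lambda>y. (f ^^ \<kappa> y) y) Q"
  proof (rule inj_onI)
    fix y y' assume y: "y \<in> Q" "y' \<in> Q" and eq: "(f ^^ \<kappa> y) y = (f ^^ \<kappa> y') y'"
    show "y = y'"
    proof (cases "\<kappa> y \<le> \<kappa> y'")
      case True
      show ?thesis
        by (rule first_return_unique[OF Q_near[OF y(1)] Q_near[OF y(2)] \<kappa>(1)[OF y(1)] True eq \<kappa>(3)[OF y(2)]])
    next
      case False
      then have le: "\<kappa> y' \<le> \<kappa> y" by simp
      show ?thesis
        by (rule first_return_unique[OF Q_near[OF y(2)] Q_near[OF y(1)] \<kappa>(1)[OF y(2)] le eq[symmetric]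
              \<kappa>(3)[OF y(1)], symmetric])
    qed
  qed
  have sub: "(\<lambda>y. (f ^^ \<kappa> y) y) ` Q \<subseteq> cuts h" using \<kappa>(2) by blast
  have finQ: "finite Q" by (rule inj_on_finite[OF inj sub finite_cuts])
  have cardQ: "card Q \<le> card (cuts h)" by (rule card_inj_on_le[OF inj sub finite_cuts])
  have marks: "marks h \<subseteq> cuts h \<union> Q"
  proof
    fix y assume "y \<in> marks h"
    then obtain k where "y \<in> near h" "(f ^^ k) y \<in> cuts h"
      "\<forall>i. 0 < i \<and> i < k \<longrightarrow> (f ^^ i) y \<notin> near h" by (auto simp: marks_def)
    then show "y \<in> cuts h \<union> Q" by (cases "k = 0") (auto simp: Q_def)
  qed
  have "card (marks h) \<le> card (cuts h \<union> Q)"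
    using marks finQ finite_cuts by (simp add: card_mono)
  also have "\<dots> \<le> card (cuts h) + card Q" by (rule card_Un_le)
  finally show ?thesis
    using cardQ card_cuts[of h] marks finQ finite_cuts by (auto intro: finite_subset)
qed

definition next_mark :: "real \<Rightarrow> real \<Rightarrow> real" where
  "next_mark h p = Min {q \<in> insert b (marks h \<union> cuts h). p < q}"

lemma next_mark:
  assumes "p \<in> near h"
  shows "p < next_mark h p" "next_mark h p \<le> b"
    and "next_mark h p \<in> insert b (marks h \<union> cuts h)"
    and "{p<..<next_mark h p} \<inter> (marks h \<union> cuts h) = {}"
proof -
  let ?Q = "{q \<in> insert b (marks h \<union> cuts h). p < q}"
  have fin: "finite ?Q"
    using marks_finite_card finite_cuts by simp
  have b: "b \<in> ?Q" using near_in[OF assms] by simp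
  have "Min ?Q \<in> ?Q" using fin b by (intro Min_in) auto
  then show "p < next_mark h p" "next_mark h p \<in> insert b (marks h \<union> cuts h)"
    by (auto simp: next_mark_def)
  show "next_mark h p \<le> b" unfolding next_mark_def using fin b by (rule Min_le)
  show "{p<..<next_mark h p} \<inter> (marks h \<union> cuts h) = {}"
  proof (rule ccontr)
    assume "\<not> ?thesis"
    then obtain q where "q \<in> {p<..<next_mark h p}" "q \<in> marks h \<union> cuts h" by blast
    then have q: "q < next_mark h p" "q \<in> ?Q" by simp_all
    have "next_mark h p \<le> q" unfolding next_mark_def using fin q(2) by (rule Min_le)
    then show False using q(1) by simp
  qed
qed

lemma column_base:
  assumes "p \<in> near h"
  shows "{p..<next_mark h p} \<subseteq> near h" "next_mark h p - p \<le> h"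
proof -
  have "{p<..<next_mark h p} \<inter> cuts h = {}" using next_mark(4)[OF assms] by blast
  moreover have "0 \<le> p" "p \<in> {p..<next_mark h p}"
    using near_in[OF assms] next_mark(1)[OF assms] by auto
  ultimately show "{p..<next_mark h p} \<subseteq> near h" "next_mark h p - p \<le> h"
    using cut_free_in_near[of p "next_mark h p"] next_mark(2)[OF assms] assms by blast+
qed

text \<open>
Levels without interior cuts that start outside \<open>near h\<close> lie outside it altogether. So a cut in the
interior of the next level would be met by the orbit of an interior point of the base before that orbit has
returned. This point would be a mark, but the base reaches only up to the next mark.
\<close>

lemma column_level:
  assumes p: "p \<in> near h" and w: "w = next_mark h p - p"
    and out: "\<forall>i. 0 < i \<and> i < j \<longrightarrow> (f ^^ i) p \<notin> near h"
  shows "\<forall>i\<le>j. translates i p w \<and> {(f ^^ i) p<..<(f ^^ i) p + w} \<inter> cuts h = {}"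
  using out
proof (induction j)
  case 0
  show ?case using next_mark(4)[OF p] by (auto simp: translates_0 w)
next
  case (Suc j)
  have IH: "translates i p w" "{(f ^^ i) p<..<(f ^^ i) p + w} \<inter> cuts h = {}" if "i \<le> j" for i
    using Suc.IH Suc.prems that by auto
  have base: "0 \<le> p" "0 < w" "p + w \<le> b"
    using near_in[OF p] next_mark(1,2)[OF p] by (auto simp: w)
  have "{(f ^^ j) p<..<(f ^^ j) p + w} \<inter> D = {}" using IH(2)[of j] by (auto simp: cuts_def)
  then have tr: "translates (Suc j) p w"
    using translates_Suc[OF IH(1) base(1,3)] by simp
  have "{(f ^^ Suc j) p<..<(f ^^ Suc j) p + w} \<inter> cuts h = {}"
  proof (rule ccontr)
    assume "\<not> ?thesis"
    then obtain u where u: "0 < u" "u < w" and cut: "(f ^^ Suc j) p + u \<in> cuts h"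
      by (force intro: that[of "_ - (f ^^ Suc j) p"])
    have q_near: "p + u \<in> near h" using column_base(1)[OF p] u by (auto simp: w)
    have q_cut: "(f ^^ Suc j) (p + u) \<in> cuts h" using translatesD[OF tr, of u] u cut by simp
    have q_out: "(f ^^ i) (p + u) \<notin> near h" if i: "0 < i" "i < Suc j" for i
    proof
      assume near: "(f ^^ i) (p + u) \<in> near h"
      have ij: "i \<le> j" using i by simp
      have eq: "(f ^^ i) (p + u) = (f ^^ i) p + u" using translatesD[OF IH(1)[OF ij], of u] u by simp
      have "(f ^^ i) p \<in> near h"
        using cut_free_in_near(1)[OF translates_image_in[OF IH(1)[OF ij] base(1,3,2)] IH(2)[OF ij],
            of "(f ^^ i) p + u"] near u unfolding eq by auto
      then show False using Suc.prems i by blast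
    qed
    have "p + u \<in> marks h" unfolding marks_def using q_near q_cut q_out by blast
    moreover have "p + u \<in> {p<..<next_mark h p}" using u by (simp add: w)
    ultimately show False using next_mark(4)[OF p] by blast
  qed
  then show ?case using tr IH by (auto simp: le_Suc_eq)
qed

definition tower :: "real \<Rightarrow> real \<Rightarrow> nat \<Rightarrow> bool" where
  "tower p w n \<longleftrightarrow> 0 \<le> p \<and> 0 < w \<and> p + w \<le> b \<and>
     (\<forall>j<n. translates j p w \<and> {(f ^^ j) p<..<(f ^^ j) p + w} \<inter> D = {}) \<and>
     (\<forall>i<n. \<forall>j<n. i \<noteq> j \<longrightarrow> w \<le> \<bar>(f ^^ i) p - (f ^^ j) p\<bar>)"

definition tower_levels :: "real \<Rightarrow> real \<Rightarrow> nat \<Rightarrow> real set" where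
  "tower_levels p w n = (\<Union>j<n. {(f ^^ j) p..<(f ^^ j) p + w})"

definition return_time :: "real \<Rightarrow> real \<Rightarrow> nat" where
  "return_time h p = (LEAST n. 0 < n \<and> (f ^^ n) p \<in> near h)"

lemma return_time:
  assumes "p \<in> near h" "0 < h"
  shows "0 < return_time h p" "(f ^^ return_time h p) p \<in> near h"
    and "0 < i \<Longrightarrow> i < return_time h p \<Longrightarrow> (f ^^ i) p \<notin> near h"
proof -
  obtain k where "(f ^^ k) (f p) \<in> near h"
    using hits_near[OF f_in[OF near_in[OF assms(1)]] assms(2)] by blast
  then have "0 < Suc k \<and> (f ^^ Suc k) p \<in> near h" by (simp add: funpow_swap1)
  then have "\<exists>n. 0 < n \<and> (f ^^ n) p \<in> near h" by blast
  then have "0 < return_time h p \<and> (f ^^ return_time h p) p \<in> near h"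
    unfolding return_time_def by (rule LeastI_ex)
  then show "0 < return_time h p" "(f ^^ return_time h p) p \<in> near h" by auto
  show "0 < i \<Longrightarrow> i < return_time h p \<Longrightarrow> (f ^^ i) p \<notin> near h"
    unfolding return_time_def using not_less_Least by blast
qed

text \<open>
A point common to two levels below the return time could be pulled back to a point of the base that
returns to \<open>near h\<close> too early. The return time is the same for all points of the base because the level
that returns contains no cut and so lies entirely in \<open>near h\<close>.
\<close>

lemma column_is_tower:
  assumes p: "p \<in> near h" and h: "0 < h" and w: "w = next_mark h p - p"
  shows "tower p w (return_time h p)"
    and "0 \<le> u \<Longrightarrow> u < w \<Longrightarrow> (f ^^ return_time h p) (p + u) \<in> near h"
proof -
  let ?n = "return_time h p"
  have base: "0 \<le> p" "0 < w" "p + w \<le> b"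
    using near_in[OF p] next_mark(1,2)[OF p] by (auto simp: w)
  have lev: "translates i p w" "{(f ^^ i) p<..<(f ^^ i) p + w} \<inter> cuts h = {}" if "i \<le> ?n" for i
    using column_level[OF p w, of ?n] return_time(3)[OF p h] that by auto
  note im = translates_image_in[OF lev(1) base(1,3,2)]
  have out: "(f ^^ i) p + u \<notin> near h" if i: "0 < i" "i < ?n" and u: "0 \<le> u" "u < w" for i u
  proof
    assume near: "(f ^^ i) p + u \<in> near h"
    have le: "i \<le> ?n" using i by simp
    have "(f ^^ i) p \<in> near h"
      using cut_free_in_near(1)[OF im[OF le] lev(2)[OF le] _ near] u by auto
    then show False using return_time(3)[OF p h i] by simp
  qed
  have base_near: "p + u \<in> near h" if "0 \<le> u" "u < w" for u
    using column_base(1)[OF p] that by (auto simp: w)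
  have sep: "w \<le> \<bar>(f ^^ i) p - (f ^^ j) p\<bar>" if ij: "i < j" "j < ?n" for i j
  proof (rule ccontr)
    assume "\<not> ?thesis"
    then obtain u v where uv: "0 \<le> u" "u < w" "0 \<le> v" "v < w" and eq: "(f ^^ i) p + u = (f ^^ j) p + v"
      using that[of "max 0 ((f ^^ j) p - (f ^^ i) p)" "max 0 ((f ^^ i) p - (f ^^ j) p)"] base(2) by auto
    have le: "i \<le> ?n" "j \<le> ?n" "j - i \<le> ?n" using ij by auto
    have "(f ^^ (i + (j - i))) (p + v) = (f ^^ i) ((f ^^ (j - i)) (p + v))"
      by (simp only: funpow_add comp_apply)
    moreover have "(f ^^ j) (p + v) = (f ^^ i) (p + u)"
      using translatesD[OF lev(1)[OF le(1)], of u] translatesD[OF lev(1)[OF le(2)], of v] uv eq by simp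
    ultimately have "(f ^^ i) (p + u) = (f ^^ i) ((f ^^ (j - i)) (p + v))"
      using ij by simp
    then have "p + u = (f ^^ (j - i)) (p + v)"
      by (rule f_pow_inject[OF near_in[OF base_near[OF uv(1,2)]] f_pow_in[OF near_in[OF base_near[OF uv(3,4)]]]])
    also have "\<dots> = (f ^^ (j - i)) p + v" using translatesD[OF lev(1)[OF le(3)]] uv by simp
    finally show False
      using base_near[OF uv(1,2)] out[of "j - i" v] ij uv by simp
  qed
  show "tower p w ?n"
    unfolding tower_def
  proof (intro conjI allI impI)
    fix i j assume "i < ?n" "j < ?n" "i \<noteq> j"
    then show "w \<le> \<bar>(f ^^ i) p - (f ^^ j) p\<bar>"
      using sep[of i j] sep[of j i] by (cases "i < j") (auto simp: abs_minus_commute)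
  next
    fix j assume j: "j < ?n"
    show "translates j p w" using lev(1) j by simp
    show "{(f ^^ j) p<..<(f ^^ j) p + w} \<inter> D = {}" using lev(2)[of j] j by (auto simp: cuts_def)
  qed (fact base)+
  show "(f ^^ ?n) (p + u) \<in> near h" if u: "0 \<le> u" "u < w"
  proof -
    have "{(f ^^ ?n) p..<(f ^^ ?n) p + w} \<subseteq> near h"
      using cut_free_in_near(1)[OF im[OF order_refl] lev(2)[OF order_refl] _ return_time(2)[OF p h]]
        base(2) by simp
    then show ?thesis using translatesD[OF lev(1)[OF order_refl] u] u by auto
  qed
qed

text \<open>
Stretching from the last mark before $y$ to the next mark or cut, a base contains $y$: an interval of
\<open>near h\<close> that contains $y$ starts with a mark, and any cut between that mark and $y$ is itself a mark.
\<close>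

lemma in_some_column:
  assumes "y \<in> near h"
  shows "\<exists>p\<in>marks h. p \<le> y \<and> y < next_mark h p"
proof -
  obtain d where d: "d \<in> insert b D" "d - h \<le> y" "y < d"
    using assms by (auto simp: near_def)
  have d_le: "d \<le> b" using d(1) D_subset by auto
  have y: "0 \<le> y" using near_in[OF assms] by simp
  have cut_mark: "a \<in> marks h" if "a \<in> cuts h" "a \<in> near h" for a
    unfolding marks_def using that by (auto intro!: exI[of _ 0])
  define a where "a = max 0 (d - h)"
  have a_le: "a \<le> y" using y d by (simp add: a_def)
  have piece: "x \<in> near h" if "a \<le> x" "x \<le> y" for x
    using that d d_le by (auto simp: near_def a_def)
  have "a \<in> cuts h" using d(1) by (auto simp: a_def cuts_def max_def)
  then have a_mark: "a \<in> marks h" using cut_mark piece a_le by simp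
  let ?M = "{q \<in> marks h. q \<le> y}"
  define p where "p = Max ?M"
  have fin: "finite ?M" using marks_finite_card by simp
  have "p \<in> ?M" unfolding p_def using fin a_mark a_le by (intro Max_in) auto
  then have p: "p \<in> marks h" "p \<le> y" by auto
  have p_max: "q \<le> p" if "q \<in> marks h" "q \<le> y" for q
    unfolding p_def using fin that by (intro Max_ge) auto
  have p_near: "p \<in> near h" using p(1) by (simp add: marks_def)
  have "y < next_mark h p"
  proof (rule ccontr)
    assume "\<not> ?thesis"
    then have le: "next_mark h p \<le> y" by simp
    have "next_mark h p \<in> near h"
      using p_max[OF a_mark a_le] next_mark(1)[OF p_near] le by (intro piece) auto
    moreover have "next_mark h p \<noteq> b" using le near_in[OF assms] by simp
    ultimately have "next_mark h p \<in> marks h"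
      using next_mark(3)[OF p_near] cut_mark by blast
    then show False using p_max[OF _ le] next_mark(1)[OF p_near] by simp
  qed
  with p show ?thesis by blast
qed

text \<open>
The most recent visit of the past orbit of $x$ to \<open>near h\<close> determines the tower that contains $x$.
\<close>

lemma columns_cover:
  assumes x: "x \<in> {0..<b}" and h: "0 < h"
  shows "\<exists>p\<in>marks h. x \<in> tower_levels p (next_mark h p - p) (return_time h p)"
proof -
  define k where "k = (LEAST k. (g ^^ k) x \<in> near h)"
  have k_near: "(g ^^ k) x \<in> near h"
    unfolding k_def using hits_near_backwards[OF x h] by (rule LeastI_ex)
  have k_min: "(g ^^ i) x \<notin> near h" if "i < k" for i
    using that not_less_Least unfolding k_def by blast
  obtain p where p: "p \<in> marks h" "p \<le> (g ^^ k) x" "(g ^^ k) x < next_mark h p"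
    using in_some_column[OF k_near] by blast
  have p_near: "p \<in> near h" using p(1) by (simp add: marks_def)
  let ?n = "return_time h p" and ?w = "next_mark h p - p"
  define u where "u = (g ^^ k) x - p"
  have u: "0 \<le> u" "u < ?w" and yu: "(g ^^ k) x = p + u" using p by (auto simp: u_def)
  note col = column_is_tower[OF p_near h refl]
  have kn: "k < ?n"
  proof (rule ccontr)
    assume "\<not> k < ?n"
    then have le: "?n \<le> k" by simp
    have "(f ^^ ?n) (p + u) \<in> near h" using col(2) u by blast
    then have "(g ^^ (k - ?n)) x \<in> near h"
      using f_pow_g_pow_diff[OF x le] by (simp only: yu)
    then show False using k_min[of "k - ?n"] return_time(1)[OF p_near h] le by auto
  qed
  have "translates k p ?w" using col(1) kn by (simp add: tower_def)
  then have "(f ^^ k) p + u = (f ^^ k) (p + u)" using translatesD u by simp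
  also have "\<dots> = x" using f_pow_g_pow[OF x, of k] by (simp only: yu)
  finally have "x \<in> {(f ^^ k) p..<(f ^^ k) p + ?w}" using u by auto
  then show ?thesis using kn p(1) unfolding tower_levels_def by blast
qed

text \<open>
The bound on the number of towers does not depend on their width. This uniformity is what lets towers of
small area be discarded.
\<close>

lemma few_towers_cover:
  assumes "0 < h"
  obtains P W N where "finite P" "card P \<le> 4 * card D + 4"
    and "\<And>p. p \<in> P \<Longrightarrow> tower p (W p) (N p)" "\<And>p. p \<in> P \<Longrightarrow> W p \<le> h"
    and "{0..<b} \<subseteq> (\<Union>p\<in>P. tower_levels p (W p) (N p))"
proof (rule that[of "marks h" "\<lambda>p. next_mark h p - p" "return_time h"])
  have near: "p \<in> near h" if "p \<in> marks h" for p using that by (simp add: marks_def)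
  show "tower p (next_mark h p - p) (return_time h p)" if "p \<in> marks h" for p
    by (rule column_is_tower(1)[OF near[OF that] assms refl])
  show "next_mark h p - p \<le> h" if "p \<in> marks h" for p
    by (rule column_base(2)[OF near[OF that]])
  show "{0..<b} \<subseteq> (\<Union>p\<in>marks h. tower_levels p (next_mark h p - p) (return_time h p))"
    using columns_cover[OF _ assms] by blast
qed (use marks_finite_card in auto)

lemma tower_levels_in:
  assumes "tower p w n" "i < n" "0 \<le> u" "u < w"
  shows "p + u \<in> {0..<b}" "(f ^^ i) (p + u) = (f ^^ i) p + u" "(f ^^ i) p + w \<le> b" "0 \<le> (f ^^ i) p"
  using assms translatesD[of i p w u] translates_image_in[of i p w] by (auto simp: tower_def)

lemma tower_area_le:
  assumes t: "tower p w n"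
  shows "real n * w \<le> b"
proof -
  let ?L = "\<lambda>j. {(f ^^ j) p..<(f ^^ j) p + w}"
  have w: "0 < w" using t by (simp add: tower_def)
  have meas: "?L j \<in> lmeasurable" for j
    using interval_union_lmeasurable(1)[of "{j}" w "\<lambda>j. (f ^^ j) p"] w by simp
  have "disjoint_family_on ?L {..<n}"
    unfolding disjoint_family_on_def using t by (fastforce simp: tower_def)
  then have "measure lebesgue (\<Union>j<n. ?L j) = (\<Sum>j<n. measure lebesgue (?L j))"
    using meas w by (intro measure_finite_Union) (auto simp: fmeasurable_def)
  then have eq: "measure lebesgue (\<Union>j<n. ?L j) = real n * w" using w by simp
  have sub: "(\<Union>j<n. ?L j) \<subseteq> {0..b}" using tower_levels_in(3,4)[OF t _ order_refl w] by fastforce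
  have "measure lebesgue (\<Union>j<n. ?L j) \<le> measure lebesgue {0..b}"
    using meas by (intro measure_mono_fmeasurable[OF sub]) auto
  then show ?thesis using eq b_pos by simp
qed

section \<open>Invariant sets contain long intervals\<close>

definition invariant :: "real set \<Rightarrow> bool" where
  "invariant S \<longleftrightarrow> S \<subseteq> {0..<b} \<and> (\<forall>x\<in>{0..<b}. f x \<in> S \<longleftrightarrow> x \<in> S)"

text \<open>
Openness in the topology generated by the half-open intervals $[x, y)$, for which $f$ and its inverse
are continuous.
\<close>

definition right_open :: "real set \<Rightarrow> bool" where
  "right_open S \<longleftrightarrow> (\<forall>x\<in>S. \<exists>w>0. {x..<x + w} \<subseteq> S)"

definition break_points_left_in :: "real set \<Rightarrow> real set" where
  "break_points_left_in S = {d \<in> D. \<exists>h>0. {d - h..<d} \<subseteq> S}"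

lemma invariant_f_pow:
  assumes "invariant S" "x \<in> {0..<b}"
  shows "(f ^^ k) x \<in> S \<longleftrightarrow> x \<in> S"
proof (induction k)
  case (Suc k)
  then show ?case using assms(1) f_pow_in[OF assms(2), of k] by (simp add: invariant_def)
qed simp

text \<open>
Starting from $x \in S$, translate a short interval $[x, x+w) \subseteq S$ until a break point $d$ obstructs
it. By invariance the part of the translate to the left of $d$ still lies in $S$, so $d$ is one of the
break points of the hypothesis, and $S'$ contains a left neighbourhood of it. If $w$ is small, the
translate of $x$ lies in that neighbourhood, whence $x \in S'$.
\<close>

lemma invariant_subset_if_break_points_subset:
  assumes S: "invariant S" "right_open S" and S': "invariant S'"
    and sub: "break_points_left_in S \<subseteq> break_points_left_in S'"
  shows "S \<subseteq> S'"
proof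
  fix x assume x: "x \<in> S"
  \<comment> \<open>One length h that fits into S' to the left of all relevant break points.\<close>
  have "\<exists>h>0. \<forall>d\<in>break_points_left_in S'. {d - h..<d} \<subseteq> S'"
  proof (rule uniform_positive_bound)
    show "finite (break_points_left_in S')" using finite_D by (simp add: break_points_left_in_def)
  next
    fix d h h' :: real
    assume "{d - h..<d} \<subseteq> S'" "h' \<le> h"
    moreover have "{d - h'..<d} \<subseteq> {d - h..<d}" using \<open>h' \<le> h\<close> by auto
    ultimately show "{d - h'..<d} \<subseteq> S'" by blast
  qed (simp add: break_points_left_in_def)
  then obtain h where h: "0 < h" "\<And>d. d \<in> break_points_left_in S' \<Longrightarrow> {d - h..<d} \<subseteq> S'" by blast
  obtain w0 where w0: "0 < w0" "{x..<x + w0} \<subseteq> S" using S(2) x by (auto simp: right_open_def)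
  define w where "w = min w0 h"
  have "{x..<x + w} \<subseteq> {x..<x + w0}" by (auto simp: w_def)
  then have w: "0 < w" "w \<le> h" "{x..<x + w} \<subseteq> S"
    using h(1) w0(1) order_trans[OF _ w0(2)] by (simp_all add: w_def)
  have S_in: "S \<subseteq> {0..<b}" using S(1) by (simp add: invariant_def)
  have x_in: "x \<in> {0..<b}" using x S_in by blast
  have "x + w \<le> b"
  proof (rule ccontr)
    assume "\<not> ?thesis"
    then have "b \<in> {x..<x + w}" using x_in by simp
    then have "b \<in> {0..<b}" using w(3) S_in by blast
    then show False by simp
  qed
  moreover have "0 \<le> x" using x_in by simp
  ultimately obtain k d where tr: "\<And>i. i \<le> k \<Longrightarrow> translates i x w"
    and d: "d \<in> D" "(f ^^ k) x < d" "d < (f ^^ k) x + w"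
    using reaches_break_point[OF _ w(1)] by metis
  have "z \<in> S" if z: "z \<in> {(f ^^ k) x..<d}" for z
  proof -
    define u where "u = z - (f ^^ k) x"
    have u: "0 \<le> u" "u < w" using z d by (auto simp: u_def)
    have xu: "x + u \<in> S" using w(3) u by auto
    have "(f ^^ k) (x + u) = z" using translatesD[OF tr[OF order_refl] u] by (simp add: u_def)
    then show ?thesis using invariant_f_pow[OF S(1), of "x + u" k] xu S_in by blast
  qed
  then have "{d - (d - (f ^^ k) x)..<d} \<subseteq> S" by auto
  then have "d \<in> break_points_left_in S"
    using d unfolding break_points_left_in_def by (intro CollectI conjI exI[of _ "d - (f ^^ k) x"]) auto
  then have "{d - h..<d} \<subseteq> S'" using sub h(2) by blast
  moreover have "(f ^^ k) x \<in> {d - h..<d}" using d w(2) by simp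
  ultimately have "(f ^^ k) x \<in> S'" by blast
  then show "x \<in> S'" using invariant_f_pow[OF S' x_in] by blast
qed

text \<open>
By the previous lemma there are at most $2^{|D|}$ right open invariant sets, one for each set of break
points, so the lengths of intervals found in the nonempty ones have a positive minimum.
\<close>

lemma invariant_contains_long_interval:
  "\<exists>\<delta>>0. \<forall>S. invariant S \<and> right_open S \<and> S \<noteq> {} \<longrightarrow> (\<exists>x. {x..<x + \<delta>} \<subseteq> S)"
proof -
  define P where "P E \<delta> \<longleftrightarrow> (\<forall>S. invariant S \<and> right_open S \<and> S \<noteq> {} \<and> break_points_left_in S = E \<longrightarrow>
    (\<exists>x. {x..<x + \<delta>} \<subseteq> S))" for E and \<delta> :: real
  have "\<exists>\<delta>>0. \<forall>E\<in>Pow D. P E \<delta>"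
  proof (rule uniform_positive_bound)
    show "finite (Pow D)" using finite_D by simp
  next
    fix E
    show "\<exists>\<delta>>0. P E \<delta>"
    proof (cases "\<exists>S. invariant S \<and> right_open S \<and> S \<noteq> {} \<and> break_points_left_in S = E")
      case True
      then obtain S x where S: "invariant S" "right_open S" "break_points_left_in S = E" "x \<in> S" by blast
      obtain w where w: "0 < w" "{x..<x + w} \<subseteq> S" using S(2,4) by (auto simp: right_open_def)
      have "P E w"
        unfolding P_def
      proof (intro allI impI)
        fix S' assume S': "invariant S' \<and> right_open S' \<and> S' \<noteq> {} \<and> break_points_left_in S' = E"
        then have "S \<subseteq> S'" using invariant_subset_if_break_points_subset[OF S(1,2)] S(3) by blast
        then show "\<exists>x. {x..<x + w} \<subseteq> S'" using w by blast
      qed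
      then show ?thesis using w(1) by blast
    next
      case False
      then show ?thesis unfolding P_def by (intro exI[of _ 1]) auto
    qed
  next
    fix E and \<delta> \<delta>' :: real
    assume P: "P E \<delta>" and le: "\<delta>' \<le> \<delta>"
    show "P E \<delta>'"
      unfolding P_def
    proof (intro allI impI)
      fix S assume "invariant S \<and> right_open S \<and> S \<noteq> {} \<and> break_points_left_in S = E"
      then obtain x where "{x..<x + \<delta>} \<subseteq> S" using P unfolding P_def by blast
      moreover have "{x..<x + \<delta>'} \<subseteq> {x..<x + \<delta>}" using le by auto
      ultimately show "\<exists>x. {x..<x + \<delta>'} \<subseteq> S" by blast
    qed
  qed
  then obtain \<delta> where \<delta>: "0 < \<delta>" "\<And>E. E \<subseteq> D \<Longrightarrow> P E \<delta>" by blast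
  have "break_points_left_in S \<subseteq> D" for S by (auto simp: break_points_left_in_def)
  then have "\<forall>S. invariant S \<and> right_open S \<and> S \<noteq> {} \<longrightarrow> (\<exists>x. {x..<x + \<delta>} \<subseteq> S)"
    using \<delta>(2) unfolding P_def by blast
  with \<delta>(1) show ?thesis by blast
qed

lemma break_free_to_the_right:
  assumes "y \<in> {0..<b}"
  shows "\<exists>w>0. y + w \<le> b \<and> {y<..<y + w} \<inter> D = {}"
proof -
  obtain e where e: "0 < e" "\<forall>d\<in>D. d \<noteq> y \<longrightarrow> e \<le> dist y d"
    using finite_set_avoid[OF finite_D] by blast
  have "d \<notin> D" if "y < d" "d < y + e" for d
    using e(2)[rule_format, of d] that by (auto simp: dist_real_def)
  then show ?thesis using e(1) assms by (intro exI[of _ "min e (b - y)"]) auto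
qed

lemma f_shift_right:
  assumes "y \<in> {0..<b}"
  shows "\<exists>w>0. \<forall>u. 0 \<le> u \<and> u < w \<longrightarrow> y + u \<in> {0..<b} \<and> f (y + u) = f y + u"
proof -
  obtain w where w: "0 < w" "y + w \<le> b" "{y<..<y + w} \<inter> D = {}"
    using break_free_to_the_right[OF assms] by blast
  have "y + u \<in> {0..<b} \<and> f (y + u) = f y + u" if "0 \<le> u \<and> u < w" for u
    using f_shift[of y "y + w" "y + u"] w assms that by auto
  then show ?thesis using w(1) by blast
qed

lemma g_shift_right:
  assumes "y \<in> {0..<b}"
  shows "\<exists>w>0. \<forall>u. 0 \<le> u \<and> u < w \<longrightarrow> y + u \<in> {0..<b} \<and> g (y + u) = g y + u"
  using piecewise_translation.f_shift_right[OF inverse_piecewise_translation assms] .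

end

section \<open>Good points of towers\<close>

text \<open>
The discontinuities of $f$ alone enter $\rho$, while the towers are built with the larger set \<open>D\<close>.
The last assumption is needed to move points by $\tau$ when only the distance to the discontinuities is
known to exceed $|\tau|$.
\<close>

locale iet_dynamics = piecewise_translation b f "inv_into {0..<b} f" D for b f D +
  assumes discont_subset: "discont b f \<subseteq> D"
    and f_shift_discont: "0 \<le> u \<Longrightarrow> v \<le> b \<Longrightarrow> {u<..<v} \<inter> discont b f = {} \<Longrightarrow> x \<in> {u..<v} \<Longrightarrow>
      f x = f u + (x - u)"
begin

abbreviation F :: "int \<Rightarrow> real \<Rightarrow> real" where "F \<equiv> iet_pow b f"

lemma finite_discont: "finite (discont b f)"
  using discont_subset finite_D by (rule finite_subset)

lemma F_of_nat: "F (int k) = f ^^ k"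
  by (simp add: iet_pow_def)

lemma F_minus_of_nat: "F (- int k) = inv_into {0..<b} f ^^ k"
  by (cases "k = 0") (simp_all add: iet_pow_def)

lemma F_in: "x \<in> {0..<b} \<Longrightarrow> F k x \<in> {0..<b}"
  unfolding iet_pow_def using f_pow_in g_pow_in by (simp del: atLeastLessThan_iff)

lemma f_F:
  assumes "x \<in> {0..<b}"
  shows "f (F k x) = F (k + 1) x"
proof (cases k rule: int_cases3)
  case (pos n)
  then show ?thesis using F_of_nat[of n] F_of_nat[of "Suc n"] by (simp add: add.commute)
next
  case (neg n)
  then obtain m where m: "n = Suc m" using not0_implies_Suc by auto
  have "k + 1 = - int m" by (simp add: neg m)
  then show ?thesis
    using F_minus_of_nat[of n] F_minus_of_nat[of m] f_g[OF g_pow_in[OF assms, of m]] by (simp add: neg m)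
qed (simp add: iet_pow_def)

lemma g_F:
  assumes "x \<in> {0..<b}"
  shows "inv_into {0..<b} f (F k x) = F (k - 1) x"
  using f_F[OF assms, of "k - 1"] g_f[OF F_in[OF assms, of "k - 1"]] by simp

lemma F_add:
  assumes "x \<in> {0..<b}"
  shows "F j (F k x) = F (j + k) x"
proof (induction j rule: int_induct[where k = 0])
  case base
  show ?case by (simp add: iet_pow_def)
next
  case (step1 i)
  have "F (i + 1) (F k x) = f (F i (F k x))" using f_F[OF F_in[OF assms]] by simp
  also have "\<dots> = F (i + 1 + k) x" using step1 f_F[OF assms] by (simp add: algebra_simps)
  finally show ?case .
next
  case (step2 i)
  have "F (i - 1) (F k x) = inv_into {0..<b} f (F i (F k x))" using g_F[OF F_in[OF assms]] by simp
  also have "\<dots> = F (i - 1 + k) x" using step2 g_F[OF assms] by (simp add: algebra_simps)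
  finally show ?case .
qed

text \<open>
The iterates of the point from time $-m$ to $m$ stay in the tower, at the same offset $u$ in pairwise
different levels. Hence they are at distance at least $w$ from each other, and the discontinuities, which
lie outside the interiors of the levels just as $0$ and $b$ do, are at distance at least $r$.
\<close>

lemma rho'_n_in_tower:
  assumes t: "tower p w n" and m: "1 \<le> m" "m \<le> j" "j + m < n"
    and r: "r \<le> u" "u \<le> w - r" "2 * r \<le> w" "0 < r"
  shows "r \<le> rho'_n b f m ((f ^^ j) p + u)"
proof -
  have u: "0 \<le> u" "u < w" using r by auto
  have "j < n" using m by simp
  note lev = tower_levels_in[OF t _ u]
  have pow: "F k ((f ^^ j) p + u) = (f ^^ nat (int j + k)) p + u" "nat (int j + k) < n"
    if k: "- int m \<le> k" "k \<le> int m" for k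
  proof -
    have i: "int (nat (int j + k)) = k + int j" using k m by simp
    show lt: "nat (int j + k) < n" using k m by linarith
    have "F k ((f ^^ j) p + u) = F k (F (int j) (p + u))"
      using lev(2)[OF \<open>j < n\<close>] by (simp add: F_of_nat)
    also have "\<dots> = F (int (nat (int j + k))) (p + u)"
      using F_add[OF lev(1)[OF \<open>j < n\<close>]] by (simp only: i)
    also have "\<dots> = (f ^^ nat (int j + k)) p + u" using lev(2)[OF lt] by (simp only: F_of_nat)
    finally show "F k ((f ^^ j) p + u) = (f ^^ nat (int j + k)) p + u" .
  qed
  have dist: "r \<le> \<bar>(f ^^ i) p + u - d\<bar>" if i: "i < n" and d: "d \<in> discont b f \<union> {0, b}" for i d
  proof -
    have "{(f ^^ i) p<..<(f ^^ i) p + w} \<inter> D = {}" using t i by (simp add: tower_def)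
    then have "d \<le> (f ^^ i) p \<or> (f ^^ i) p + w \<le> d"
      using d discont_subset lev(3,4)[OF i] by (force simp: disjoint_iff)
    then show ?thesis using r by auto
  qed
  have sep: "2 * r \<le> \<bar>(f ^^ i) p + u - ((f ^^ i') p + u)\<bar>" if "i < n" "i' < n" "i \<noteq> i'" for i i'
  proof -
    have "w \<le> \<bar>(f ^^ i) p - (f ^^ i') p\<bar>" using t that unfolding tower_def by blast
    then show ?thesis using r by simp
  qed
  show ?thesis
    unfolding le_rho'_n_iff[OF finite_discont m(1)]
  proof (intro conjI ballI allI impI)
    fix k d assume "k \<in> {- int m..int m - 1}" "d \<in> discont b f \<union> {0, b}"
    then show "r \<le> \<bar>F k ((f ^^ j) p + u) - d\<bar>" using pow[of k] dist by simp
  next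
    fix k l assume kl: "\<bar>k\<bar> \<le> int m \<and> \<bar>l\<bar> \<le> int m \<and> k \<noteq> l"
    then have b: "- int m \<le> k" "k \<le> int m" "- int m \<le> l" "l \<le> int m" by auto
    have "nat (int j + k) \<noteq> nat (int j + l)" using b kl m by auto
    then show "2 * r \<le> \<bar>F k ((f ^^ j) p + u) - F l ((f ^^ j) p + u)\<bar>"
      using pow[OF b(1,2)] pow[OF b(3,4)] sep by simp
  qed
qed

text \<open>
The bad points are the whole tower if its area $nw$ is less than $\beta$, and otherwise the $m$ lowest and
the $m$ highest levels together with the two margins of width $\eta w$ of each level, where
$m = \lfloor \eta n \rfloor$. That is an area of at most $4 \eta n w \le 4 \eta b$. The condition on $h$
makes the tower so thin, hence so high, that $m \ge M$ and that rounding $m$ down costs at most half of the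
lower bound.
\<close>

lemma tower_mostly_good:
  assumes t: "tower p w n" and w: "w \<le> h"
    and \<eta>: "0 < \<eta>" "\<eta> \<le> 1 / 2" and \<beta>: "0 < \<beta>" and M: "1 \<le> M" "h * (real M + 1) \<le> \<eta> * \<beta>"
  shows "\<exists>B\<in>lmeasurable. measure lebesgue B \<le> 4 * \<eta> * b + \<beta> \<and>
    (\<forall>x\<in>tower_levels p w n - B. \<exists>m\<ge>M. \<eta>\<^sup>2 * \<beta> / 2 \<le> real m * rho'_n b f m x)"
proof (cases "real n * w < \<beta>")
  case True
  have "0 \<le> w" using t by (simp add: tower_def)
  then have "tower_levels p w n \<in> lmeasurable" "measure lebesgue (tower_levels p w n) \<le> real n * w"
    using interval_union_lmeasurable[of "{..<n}" w "\<lambda>j. (f ^^ j) p"] by (simp_all add: tower_levels_def)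
  moreover have "0 \<le> 4 * \<eta> * b" using \<eta> b_pos by simp
  ultimately show ?thesis using True by (intro bexI[of _ "tower_levels p w n"]) auto
next
  case False
  have w0: "0 < w" using t by (simp add: tower_def)
  define m where "m = nat \<lfloor>\<eta> * real n\<rfloor>"
  define r where "r = \<eta> * w"
  have "w * (real M + 1) \<le> h * (real M + 1)" using w by (intro mult_right_mono) auto
  also have "\<dots> \<le> \<eta> * \<beta>" by (rule M)
  also have "\<dots> \<le> \<eta> * (real n * w)" using False \<eta> by (intro mult_left_mono) auto
  also have "\<dots> = w * (\<eta> * real n)" by (simp add: algebra_simps)
  finally have Mn: "real M + 1 \<le> \<eta> * real n" using w0 by simp
  have m_le: "real m \<le> \<eta> * real n" unfolding m_def using \<eta> by simp
  have m_ge: "\<eta> * real n - 1 \<le> real m" unfolding m_def using \<eta> by linarith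
  have mM: "M \<le> m" using Mn m_ge by simp
  have "2 * h \<le> h * (real M + 1)" using M w w0 by simp
  then have h2: "2 * h \<le> \<eta> * \<beta>" using M by simp
  have r: "0 < r" "2 * r \<le> w" using \<eta> w0 by (auto simp: r_def)
  have bound: "\<eta>\<^sup>2 * \<beta> / 2 \<le> real m * r"
  proof -
    have "\<eta> * \<beta> / 2 \<le> \<eta> * \<beta> - h" using h2 by linarith
    also have "\<dots> \<le> \<eta> * (real n * w) - w" using False \<eta> w by (intro diff_mono mult_left_mono) auto
    also have "\<dots> \<le> real m * w" using mult_right_mono[OF m_ge less_imp_le[OF w0]] by (simp add: algebra_simps)
    finally have "\<eta> * (\<eta> * \<beta> / 2) \<le> \<eta> * (real m * w)" using \<eta> by (intro mult_left_mono) auto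
    then show ?thesis by (simp add: r_def power2_eq_square algebra_simps)
  qed
  let ?B1 = "\<Union>j\<in>{..<m} \<union> {n - m..<n}. {(f ^^ j) p..<(f ^^ j) p + w}"
  let ?B2 = "\<Union>j<n. {(f ^^ j) p..<(f ^^ j) p + r}"
  let ?B3 = "\<Union>j<n. {(f ^^ j) p + (w - r)..<(f ^^ j) p + (w - r) + r}"
  define B where "B = ?B1 \<union> ?B2 \<union> ?B3"
  have lm: "?B1 \<in> lmeasurable" "?B2 \<in> lmeasurable" "?B3 \<in> lmeasurable"
    using w0 r by (intro interval_union_lmeasurable(1); simp)+
  have "card ({..<m} \<union> {n - m..<n}) \<le> 2 * m"
    using card_Un_le[of "{..<m}" "{n - m..<n}"] by simp
  then have "real (card ({..<m} \<union> {n - m..<n})) \<le> real (2 * m)"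
    by (simp only: of_nat_le_iff)
  then have card_w: "real (card ({..<m} \<union> {n - m..<n})) * w \<le> real (2 * m) * w"
    using w0 by (intro mult_right_mono) auto
  have "measure lebesgue ?B1 \<le> real (card ({..<m} \<union> {n - m..<n})) * w"
    using w0 by (intro interval_union_lmeasurable(2)) auto
  also note card_w
  finally have b1: "measure lebesgue ?B1 \<le> 2 * m * w" by simp
  have b2: "measure lebesgue ?B2 \<le> n * r"
    using interval_union_lmeasurable(2)[of "{..<n}" r "\<lambda>j. (f ^^ j) p"] r by simp
  have b3: "measure lebesgue ?B3 \<le> n * r"
    using interval_union_lmeasurable(2)[of "{..<n}" r "\<lambda>j. (f ^^ j) p + (w - r)"] r by simp
  have "measure lebesgue B \<le> measure lebesgue (?B1 \<union> ?B2) + measure lebesgue ?B3"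
    unfolding B_def using lm by (intro measure_Un_le) auto
  also have "measure lebesgue (?B1 \<union> ?B2) \<le> measure lebesgue ?B1 + measure lebesgue ?B2"
    using lm by (intro measure_Un_le) auto
  finally have "measure lebesgue B \<le> 2 * m * w + n * r + n * r" using b1 b2 b3 by linarith
  also have "\<dots> \<le> 2 * (\<eta> * n) * w + n * r + n * r" using m_le w0 by simp
  also have "\<dots> = 4 * \<eta> * (n * w)" by (simp add: r_def)
  also have "\<dots> \<le> 4 * \<eta> * b" using tower_area_le[OF t] \<eta> by (intro mult_left_mono) auto
  finally have small: "measure lebesgue B \<le> 4 * \<eta> * b + \<beta>" using \<beta> by simp
  have good: "\<exists>m\<ge>M. \<eta>\<^sup>2 * \<beta> / 2 \<le> real m * rho'_n b f m x" if x: "x \<in> tower_levels p w n - B" for x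
  proof -
    obtain j where j: "j < n" "(f ^^ j) p \<le> x" "x < (f ^^ j) p + w"
      using x by (auto simp: tower_levels_def)
    have "j \<notin> {..<m} \<union> {n - m..<n}" "\<not> x < (f ^^ j) p + r" "\<not> (f ^^ j) p + (w - r) \<le> x"
      using x j by (auto simp: B_def)
    then have "r \<le> rho'_n b f m ((f ^^ j) p + (x - (f ^^ j) p))"
      using j M(1) mM r by (intro rho'_n_in_tower[OF t]) auto
    then have "real m * r \<le> real m * rho'_n b f m x" by (intro mult_left_mono) auto
    then show ?thesis using mM bound by (meson order_trans)
  qed
  show ?thesis using lm small good by (intro bexI[of _ B]) (auto simp: B_def)
qed

lemma mostly_good:
  assumes s: "0 < s"
  shows "\<exists>c>0. \<forall>M\<ge>1. \<exists>B\<in>lmeasurable. measure lebesgue B \<le> s \<and>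
    (\<forall>x\<in>{0..<b} - B. \<exists>m\<ge>M. c \<le> real m * rho'_n b f m x)"
proof -
  define K :: real where "K = 4 * card D + 4"
  \<comment> \<open>K bounds the number of towers; each half of s / K pays for one kind of bad set.\<close>
  define \<beta> where "\<beta> = s / (2 * K)"
  define \<eta> where "\<eta> = min (1 / 2) (s / (8 * b * K))"
  have K: "0 < K" by (simp add: K_def)
  have \<beta>: "0 < \<beta>" and \<eta>: "0 < \<eta>" "\<eta> \<le> 1 / 2"
    using s K b_pos by (auto simp: \<beta>_def \<eta>_def)
  have "\<eta> \<le> s / (8 * b * K)" by (simp add: \<eta>_def)
  then have "4 * \<eta> * b \<le> \<beta>" using K b_pos by (simp add: \<beta>_def field_simps)
  then have total: "K * (4 * \<eta> * b + \<beta>) \<le> s" using K by (simp add: \<beta>_def field_simps)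
  have "\<exists>B\<in>lmeasurable. measure lebesgue B \<le> s \<and>
    (\<forall>x\<in>{0..<b} - B. \<exists>m\<ge>M. \<eta>\<^sup>2 * \<beta> / 2 \<le> real m * rho'_n b f m x)" if M: "1 \<le> M" for M
  proof -
    define h where "h = \<eta> * \<beta> / (real M + 1)"
    have h: "0 < h" "h * (real M + 1) \<le> \<eta> * \<beta>" using \<eta> \<beta> by (auto simp: h_def)
    obtain P W N where P: "finite P" "card P \<le> 4 * card D + 4"
      and t: "\<And>p. p \<in> P \<Longrightarrow> tower p (W p) (N p)" "\<And>p. p \<in> P \<Longrightarrow> W p \<le> h"
      and cover: "{0..<b} \<subseteq> (\<Union>p\<in>P. tower_levels p (W p) (N p))"
      by (rule few_towers_cover[OF h(1)]) (rule that)
    have "\<forall>p\<in>P. \<exists>B. B \<in> lmeasurable \<and> measure lebesgue B \<le> 4 * \<eta> * b + \<beta> \<and>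
      (\<forall>x\<in>tower_levels p (W p) (N p) - B. \<exists>m\<ge>M. \<eta>\<^sup>2 * \<beta> / 2 \<le> real m * rho'_n b f m x)"
      using tower_mostly_good[OF t \<eta> \<beta> M h(2)] by blast
    from bchoice[OF this] obtain B where B: "\<And>p. p \<in> P \<Longrightarrow> B p \<in> lmeasurable"
      "\<And>p. p \<in> P \<Longrightarrow> measure lebesgue (B p) \<le> 4 * \<eta> * b + \<beta>"
      "\<And>p x. p \<in> P \<Longrightarrow> x \<in> tower_levels p (W p) (N p) - B p \<Longrightarrow>
         \<exists>m\<ge>M. \<eta>\<^sup>2 * \<beta> / 2 \<le> real m * rho'_n b f m x" by blast
    have "measure lebesgue (\<Union>p\<in>P. B p) \<le> (\<Sum>p\<in>P. measure lebesgue (B p))"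
      using P(1) B(1) by (intro measure_UNION_le) auto
    also have "\<dots> \<le> card P * (4 * \<eta> * b + \<beta>)" using B(2) by (intro sum_bounded_above) auto
    also have "\<dots> \<le> K * (4 * \<eta> * b + \<beta>)"
    proof (rule mult_right_mono)
      have "real (card P) \<le> real (4 * card D + 4)" using P(2) by (simp only: of_nat_le_iff)
      then show "real (card P) \<le> K" by (simp add: K_def)
    qed (use \<eta> \<beta> b_pos in simp)
    finally have "measure lebesgue (\<Union>p\<in>P. B p) \<le> s" using total by simp
    moreover have "(\<Union>p\<in>P. B p) \<in> lmeasurable" using P(1) B(1) by (intro fmeasurable.finite_UN) auto
    moreover have "\<exists>m\<ge>M. \<eta>\<^sup>2 * \<beta> / 2 \<le> real m * rho'_n b f m x" if x: "x \<in> {0..<b} - (\<Union>p\<in>P. B p)" for x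
    proof -
      obtain p where "p \<in> P" "x \<in> tower_levels p (W p) (N p)" using cover x by blast
      then show ?thesis using B(3)[of p x] x by blast
    qed
    ultimately show ?thesis by blast
  qed
  then show ?thesis using \<eta>(1) \<beta> by (intro exI[of _ "\<eta>\<^sup>2 * \<beta> / 2"]) auto
qed

definition recurrently_good :: "real \<Rightarrow> real \<Rightarrow> bool" where
  "recurrently_good c x \<longleftrightarrow> (\<forall>M. \<exists>m\<ge>M. c \<le> real m * rho'_n b f m x)"

text \<open>
For each $M$ let $B_M$ be the exceptional set of \<open>mostly_good\<close>. A point that is not recurrently good
lies in all $B_M$ from some index on. The set of these points is the increasing union of the sets
$\bigcap_{M \ge k} B_M$, each of measure at most $s$, so it has measure at most $s$ as well.
\<close>

lemma recurrently_good_up_to_small_measure: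
  assumes s: "0 < s"
  obtains c Z where "0 < c" "Z \<in> lmeasurable" "measure lebesgue Z \<le> s"
    "\<And>x. x \<in> {0..<b} - Z \<Longrightarrow> recurrently_good c x"
proof -
  obtain c where c: "0 < c" and ex: "\<forall>M\<ge>1. \<exists>B\<in>lmeasurable. measure lebesgue B \<le> s \<and>
    (\<forall>x\<in>{0..<b} - B. \<exists>m\<ge>M. c \<le> real m * rho'_n b f m x)"
    using mostly_good[OF s] by blast
  have "\<exists>B. B \<in> lmeasurable \<and> measure lebesgue B \<le> s \<and>
    (\<forall>x\<in>{0..<b} - B. \<exists>m\<ge>Suc M. c \<le> real m * rho'_n b f m x)" for M
    using ex[rule_format, of "Suc M"] by auto
  then obtain B where B: "\<And>M. B M \<in> lmeasurable" "\<And>M. measure lebesgue (B M) \<le> s"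
    "\<And>M x. x \<in> {0..<b} - B M \<Longrightarrow> \<exists>m\<ge>Suc M. c \<le> real m * rho'_n b f m x"
    by metis
  define S where "S k = (\<Inter>M\<in>{k..}. B M)" for k
  have S_sub: "S k \<subseteq> B k" for k by (auto simp: S_def)
  have S_sets: "S k \<in> sets lebesgue" for k
    unfolding S_def using B(1) by (intro sets.countable_INT') (auto simp: fmeasurableD)
  have S_meas: "S k \<in> lmeasurable" for k
    using fmeasurableI2[OF B(1) S_sub S_sets] .
  have S_le: "measure lebesgue (S k) \<le> s" for k
    using measure_mono_fmeasurable[OF S_sub S_sets B(1)] B(2)[of k] by (rule order_trans)
  have S_mono: "S k \<subseteq> S (Suc k)" for k by (auto simp: S_def)
  have "(\<lambda>k. measure lebesgue (S k)) \<longlonglongrightarrow> measure lebesgue (\<Union>k. S k)"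
    by (rule measure_nested_Union[of S, OF S_meas S_le S_mono])
  then have S_small: "measure lebesgue (\<Union>k. S k) \<le> s"
    by (rule LIMSEQ_le_const2) (use S_le in blast)
  have S_lm: "(\<Union>k. S k) \<in> lmeasurable" by (rule measurable_nested_Union[of S, OF S_meas S_le S_mono])
  have "recurrently_good c x" if x: "x \<in> {0..<b} - (\<Union>k. S k)" for x
    unfolding recurrently_good_def
  proof
    fix k
    obtain M where "k \<le> M" "x \<notin> B M" using x by (auto simp: S_def)
    then obtain m where "Suc M \<le> m" "c \<le> real m * rho'_n b f m x" using B(3)[of x M] x by blast
    then show "\<exists>m\<ge>k. c \<le> real m * rho'_n b f m x" using \<open>k \<le> M\<close> by (intro exI[of _ m]) auto
  qed
  then show thesis by (rule that[OF c S_lm S_small])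
qed

section \<open>Density of recurrently good points\<close>

lemma F_shift_right:
  assumes x: "x \<in> {0..<b}"
  shows "\<exists>w>0. \<forall>u. 0 \<le> u \<and> u < w \<longrightarrow> x + u \<in> {0..<b} \<and> F k (x + u) = F k x + u"
proof (induction k rule: int_induct[where k = 0])
  case base
  show ?case using f_shift_right[OF x] by (auto simp: iet_pow_def)
next
  case (step1 i)
  obtain w where w: "0 < w" "\<And>u. 0 \<le> u \<and> u < w \<Longrightarrow> x + u \<in> {0..<b} \<and> F i (x + u) = F i x + u"
    using step1 by blast
  obtain w' where w': "0 < w'" "\<And>u. 0 \<le> u \<and> u < w' \<Longrightarrow> f (F i x + u) = f (F i x) + u"
    using f_shift_right[OF F_in[OF x]] by blast
  have "x + u \<in> {0..<b} \<and> F (i + 1) (x + u) = F (i + 1) x + u" if u: "0 \<le> u \<and> u < min w w'" for u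
    using w(2)[of u] w'(2)[of u] f_F[OF x, of i] f_F[of "x + u" i] u by simp
  then show ?case using w(1) w'(1) by (intro exI[of _ "min w w'"]) auto
next
  case (step2 i)
  obtain w where w: "0 < w" "\<And>u. 0 \<le> u \<and> u < w \<Longrightarrow> x + u \<in> {0..<b} \<and> F i (x + u) = F i x + u"
    using step2 by blast
  obtain w' where w': "0 < w'"
    "\<And>u. 0 \<le> u \<and> u < w' \<Longrightarrow> inv_into {0..<b} f (F i x + u) = inv_into {0..<b} f (F i x) + u"
    using g_shift_right[OF F_in[OF x]] by blast
  have "x + u \<in> {0..<b} \<and> F (i - 1) (x + u) = F (i - 1) x + u" if u: "0 \<le> u \<and> u < min w w'" for u
    using w(2)[of u] w'(2)[of u] g_F[OF x, of i] g_F[of "x + u" i] u by simp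
  then show ?case using w(1) w'(1) by (intro exI[of _ "min w w'"]) auto
qed

definition saturation :: "real set \<Rightarrow> real set" where
  "saturation U = {x \<in> {0..<b}. \<exists>k. F k x \<in> U}"

lemma invariant_saturation: "invariant (saturation U)"
  unfolding invariant_def
proof (intro conjI ballI)
  show "saturation U \<subseteq> {0..<b}" by (auto simp: saturation_def)
  fix x assume x: "x \<in> {0..<b}"
  have eq: "F k (f x) = F (k + 1) x" for k
    using F_add[OF x, of k 1] by (simp add: iet_pow_def)
  have "(\<exists>k. F k (f x) \<in> U) \<longleftrightarrow> (\<exists>k. F k x \<in> U)"
    unfolding eq by (metis diff_add_cancel)
  then show "f x \<in> saturation U \<longleftrightarrow> x \<in> saturation U"
    using x f_in[OF x] by (simp add: saturation_def)
qed

lemma right_open_saturation: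
  assumes U: "open U"
  shows "right_open (saturation U)"
  unfolding right_open_def
proof
  fix x assume "x \<in> saturation U"
  then obtain k where x: "x \<in> {0..<b}" and k: "F k x \<in> U" by (auto simp: saturation_def)
  obtain w where w: "0 < w" "\<And>u. 0 \<le> u \<and> u < w \<Longrightarrow> x + u \<in> {0..<b} \<and> F k (x + u) = F k x + u"
    using F_shift_right[OF x] by blast
  obtain e where e: "0 < e" "ball (F k x) e \<subseteq> U" using U k openE by blast
  have "z \<in> saturation U" if z: "z \<in> {x..<x + min w e}" for z
  proof -
    have "z \<in> {0..<b}" "F k z = F k x + (z - x)" using w(2)[of "z - x"] z by auto
    moreover from this z have "F k z \<in> U" using e(2) by (auto simp: dist_real_def)
    ultimately show ?thesis unfolding saturation_def by blast
  qed
  then show "\<exists>w>0. {x..<x + w} \<subseteq> saturation U" using w(1) e(1) by (intro exI[of _ "min w e"]) auto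
qed

text \<open>
The time window of length $n - |k|$ around $f^k(x)$ is contained in the one of length $n$ around $x$.
\<close>

lemma rho'_n_orbit:
  assumes x: "x \<in> {0..<b}" and k: "nat \<bar>k\<bar> < n"
  shows "rho'_n b f n x \<le> rho'_n b f (n - nat \<bar>k\<bar>) (F k x)"
proof -
  let ?m = "n - nat \<bar>k\<bar>"
  have n: "1 \<le> n" "1 \<le> ?m" "int ?m = int n - \<bar>k\<bar>" using k by auto
  have le: "rho'_n b f n x \<le> rho'_n b f n x" ..
  note bound = le[unfolded le_rho'_n_iff[OF finite_discont n(1), of "rho'_n b f n x"]]
  show ?thesis
    unfolding le_rho'_n_iff[OF finite_discont n(2)] F_add[OF x]
  proof (intro conjI ballI allI impI)
    fix j d assume "j \<in> {- int ?m..int ?m - 1}" and d: "d \<in> discont b f \<union> {0, b}"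
    then have "j + k \<in> {- int n..int n - 1}" using n(3) by auto
    then show "rho'_n b f n x \<le> \<bar>F (j + k) x - d\<bar>" using bound d by blast
  next
    fix p q assume "\<bar>p\<bar> \<le> int ?m \<and> \<bar>q\<bar> \<le> int ?m \<and> p \<noteq> q"
    then have "\<bar>p + k\<bar> \<le> int n \<and> \<bar>q + k\<bar> \<le> int n \<and> p + k \<noteq> q + k" using n(3) by auto
    then show "2 * rho'_n b f n x \<le> \<bar>F (p + k) x - F (q + k) x\<bar>" using bound by blast
  qed
qed

text \<open>
The shift by $k$ costs at most half of the window once $n \ge 2|k|$, and with it half of the constant.
\<close>

lemma recurrently_good_orbit:
  assumes x: "x \<in> {0..<b}" and c: "0 < c" and good: "recurrently_good c x"
  shows "recurrently_good (c / 2) (F k x)"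
  unfolding recurrently_good_def
proof
  fix M
  let ?k = "nat \<bar>k\<bar>"
  obtain n where n: "Suc (2 * ?k + M) \<le> n" "c \<le> real n * rho'_n b f n x"
    using good unfolding recurrently_good_def by blast
  define m where "m = n - ?k"
  have m: "M \<le> m" "n \<le> 2 * m" using n(1) by (auto simp: m_def)
  have le: "rho'_n b f n x \<le> rho'_n b f m (F k x)"
    unfolding m_def using n(1) by (intro rho'_n_orbit[OF x]) simp
  have pos: "0 < rho'_n b f n x"
    using n(2) c by (smt (verit) mult_nonneg_nonpos of_nat_0_le_iff)
  have "c \<le> (2 * real m) * rho'_n b f n x"
    using n(2) mult_right_mono[OF _ less_imp_le[OF pos], of "real n" "2 * real m"] m(2) by simp
  also have "\<dots> \<le> (2 * real m) * rho'_n b f m (F k x)" using le by (intro mult_left_mono) auto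
  finally show "\<exists>m\<ge>M. c / 2 \<le> real m * rho'_n b f m (F k x)" using m(1) by (intro exI[of _ m]) auto
qed

text \<open>
The saturation of an interval contains an interval of length $\delta$ independent of the given one,
so an exceptional set of measure at most $\delta/2$ cannot swallow it. A good point of the saturation is
then carried back into the given interval along its orbit.
\<close>

lemma recurrently_good_dense:
  "\<exists>c>0. \<forall>u v. 0 \<le> u \<and> u < v \<and> v \<le> b \<longrightarrow> (\<exists>x\<in>{u<..<v}. recurrently_good c x)"
proof -
  obtain \<delta> where \<delta>: "0 < \<delta>" "\<forall>S. invariant S \<and> right_open S \<and> S \<noteq> {} \<longrightarrow> (\<exists>x. {x..<x + \<delta>} \<subseteq> S)"
    using invariant_contains_long_interval by blast
  have "0 < \<delta> / 2" using \<delta>(1) by simp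
  then obtain c Z where c: "0 < c" and Z: "Z \<in> lmeasurable" "measure lebesgue Z \<le> \<delta> / 2"
    and good: "\<And>x. x \<in> {0..<b} - Z \<Longrightarrow> recurrently_good c x"
    using recurrently_good_up_to_small_measure by blast
  have "\<exists>x\<in>{u<..<v}. recurrently_good (c / 2) x" if uv: "0 \<le> u \<and> u < v \<and> v \<le> b" for u v
  proof -
    let ?S = "saturation {u<..<v}"
    have "(u + v) / 2 \<in> ?S" using uv by (auto simp: saturation_def iet_pow_def intro!: exI[of _ 0])
    then have "?S \<noteq> {}" by blast
    then have "\<exists>x. {x..<x + \<delta>} \<subseteq> ?S"
      using invariant_saturation right_open_saturation[OF open_greaterThanLessThan]
      by (intro \<delta>(2)[rule_format] conjI)
    then obtain x where x: "{x..<x + \<delta>} \<subseteq> ?S" ..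
    have "\<not> {x..<x + \<delta>} \<subseteq> Z"
    proof
      assume "{x..<x + \<delta>} \<subseteq> Z"
      then have "measure lebesgue {x..<x + \<delta>} \<le> measure lebesgue Z"
        using Z(1) by (intro measure_mono_fmeasurable) auto
      then show False using Z(2) \<delta>(1) by simp
    qed
    then obtain z where z: "z \<in> ?S" "z \<notin> Z" using x by blast
    then obtain k where k: "z \<in> {0..<b}" "F k z \<in> {u<..<v}" by (auto simp: saturation_def)
    have "recurrently_good (c / 2) (F k z)"
      using recurrently_good_orbit[OF k(1) c] good z k by blast
    then show ?thesis using k(2) by blast
  qed
  then show ?thesis using c by (intro exI[of _ "c / 2"]) auto
qed

section \<open>The critical set is null and meager\<close>

lemma f_shift_near:
  assumes "y \<in> {0..<b}" "\<forall>d\<in>discont b f \<union> {0, b}. r \<le> \<bar>y - d\<bar>" "\<bar>\<tau>\<bar> < r"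
  shows "y + \<tau> \<in> {0..<b}" "f (y + \<tau>) = f y + \<tau>"
proof -
  have r: "r \<le> y" "r \<le> b - y" using assms(1,2) by auto
  have free: "{y - r<..<y + r} \<inter> discont b f = {}" using assms(2) by fastforce
  have shift: "f z = f (y - r) + (z - (y - r))" if "z \<in> {y - r..<y + r}" for z
    using f_shift_discont[OF _ _ free that] r by simp
  show "y + \<tau> \<in> {0..<b}" using r assms(3) by auto
  have "y \<in> {y - r..<y + r}" "y + \<tau> \<in> {y - r..<y + r}" using assms(3) by auto
  then show "f (y + \<tau>) = f y + \<tau>" using shift[of y] shift[of "y + \<tau>"] by simp
qed

text \<open>
As long as the orbit of $x$ keeps distance at least $r$ from the discontinuities and from the ends of the
space, $f$ translates the $r$-neighbourhoods of its points onto each other. For negative $k$ the step goes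
through the preimage $f^k(x)$, which is why the window in the definition of $\rho_n$ reaches back to $-n$ but
only up to $n-1$.
\<close>

lemma F_shift_near:
  assumes x: "x \<in> {0..<b}" and \<tau>: "\<bar>\<tau>\<bar> < r"
    and far: "\<forall>k\<in>{- int n..int n - 1}. \<forall>d\<in>discont b f \<union> {0, b}. r \<le> \<bar>F k x - d\<bar>"
    and n: "1 \<le> n" and k: "\<bar>k\<bar> \<le> int n"
  shows "F k (x + \<tau>) = F k x + \<tau>"
proof -
  have near: "F k x + \<tau> \<in> {0..<b}" "f (F k x + \<tau>) = f (F k x) + \<tau>" if "k \<in> {- int n..int n - 1}" for k
    using f_shift_near[OF F_in[OF x] _ \<tau>] far that by blast+
  have x\<tau>: "x + \<tau> \<in> {0..<b}" using near(1)[of 0] n by (simp add: iet_pow_def)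
  have fwd: "F (int i) (x + \<tau>) = F (int i) x + \<tau>" if "i \<le> n" for i
    using that
  proof (induction i)
    case (Suc i)
    have "F (int i + 1) (x + \<tau>) = f (F (int i) x + \<tau>)" using Suc f_F[OF x\<tau>, of "int i"] by simp
    also have "\<dots> = F (int i + 1) x + \<tau>" using near(2)[of "int i"] Suc.prems f_F[OF x, of "int i"] by simp
    finally show ?case by (simp add: add.commute)
  qed (simp add: iet_pow_def)
  have bwd: "F (- int i) (x + \<tau>) = F (- int i) x + \<tau>" if "i \<le> n" for i
    using that
  proof (induction i)
    case (Suc i)
    have mem: "- int i - 1 \<in> {- int n..int n - 1}" using Suc.prems by simp
    have "F (- int i - 1) (x + \<tau>) = inv_into {0..<b} f (F (- int i) x + \<tau>)"
      using Suc g_F[OF x\<tau>, of "- int i"] by simp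
    also have "F (- int i) x + \<tau> = f (F (- int i - 1) x + \<tau>)"
      using near(2)[OF mem] f_F[OF x, of "- int i - 1"] by simp
    also have "inv_into {0..<b} f \<dots> = F (- int i - 1) x + \<tau>" by (rule g_f[OF near(1)[OF mem]])
    finally have "F (- int i - 1) (x + \<tau>) = F (- int i - 1) x + \<tau>" .
    moreover have "- int (Suc i) = - int i - 1" by simp
    ultimately show ?case by (simp only:)
  qed (simp add: iet_pow_def)
  show ?thesis
  proof (cases "0 \<le> k")
    case True
    then show ?thesis using fwd[of "nat k"] k by simp
  next
    case False
    then show ?thesis using bwd[of "nat (- k)"] k by simp
  qed
qed

text \<open>
Moving $x$ by $\tau$ moves all its iterates of the window by $\tau$, so that it changes no mutual
distance and changes the distances to the discontinuities by at most $|\tau|$.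
\<close>

lemma rho'_n_near:
  assumes x: "x \<in> {0..<b}" and n: "1 \<le> n" and \<tau>: "\<bar>\<tau>\<bar> < rho'_n b f n x"
  shows "rho'_n b f n x - \<bar>\<tau>\<bar> \<le> rho'_n b f n (x + \<tau>)"
proof -
  let ?r = "rho'_n b f n x"
  have le: "?r \<le> ?r" ..
  note bound = le[unfolded le_rho'_n_iff[OF finite_discont n, of ?r]]
  have shift: "F k (x + \<tau>) = F k x + \<tau>" if "\<bar>k\<bar> \<le> int n" for k
    using F_shift_near[OF x \<tau> _ n that] bound by blast
  show ?thesis
    unfolding le_rho'_n_iff[OF finite_discont n]
  proof (intro conjI ballI allI impI)
    fix k d assume k: "k \<in> {- int n..int n - 1}" and d: "d \<in> discont b f \<union> {0, b}"
    have "?r \<le> \<bar>F k x - d\<bar>" using bound k d by blast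
    moreover have "F k (x + \<tau>) = F k x + \<tau>" using k by (intro shift) auto
    ultimately show "?r - \<bar>\<tau>\<bar> \<le> \<bar>F k (x + \<tau>) - d\<bar>" by simp
  next
    fix p q assume pq: "\<bar>p\<bar> \<le> int n \<and> \<bar>q\<bar> \<le> int n \<and> p \<noteq> q"
    then have "2 * ?r \<le> \<bar>F p x - F q x\<bar>" using bound by blast
    then show "2 * (?r - \<bar>\<tau>\<bar>) \<le> \<bar>F p (x + \<tau>) - F q (x + \<tau>)\<bar>" using shift pq by simp
  qed
qed

lemma eventually_small_if_psi_zero:
  assumes "psi b f x = 0" "0 < c"
  shows "\<exists>M. \<forall>n\<ge>M. real n * rho'_n b f n x < c"
proof -
  have "limsup (\<lambda>n. ereal (real n * rho'_n b f n x)) < ereal c"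
    using assms by (simp add: psi_def)
  then have "\<forall>\<^sub>F n in sequentially. ereal (real n * rho'_n b f n x) < ereal c"
    by (rule Limsup_lessD)
  then obtain M where "\<forall>n\<ge>M. real n * rho'_n b f n x < c"
    by (auto simp: eventually_sequentially)
  then show ?thesis by blast
qed

lemma critical_set_null: "critical_set b f \<in> null_sets lebesgue"
  unfolding negligible_iff_null_sets[symmetric] negligible_outer_le
proof (intro allI impI)
  fix s :: real assume "0 < s"
  then obtain c Z where c: "0 < c" and Z: "Z \<in> lmeasurable" "measure lebesgue Z \<le> s"
    and good: "\<And>x. x \<in> {0..<b} - Z \<Longrightarrow> recurrently_good c x"
    using recurrently_good_up_to_small_measure by blast
  have "critical_set b f \<subseteq> Z"
  proof
    fix x assume x: "x \<in> critical_set b f"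
    then have "psi b f x = 0" by (simp add: critical_set_def)
    then obtain M where "\<forall>n\<ge>M. real n * rho'_n b f n x < c"
      using eventually_small_if_psi_zero[OF _ c] by blast
    then have "\<not> recurrently_good c x" unfolding recurrently_good_def by (meson not_le)
    then show "x \<in> Z" using good[of x] x by (auto simp: critical_set_def)
  qed
  then show "\<exists>Z. critical_set b f \<subseteq> Z \<and> Z \<in> lmeasurable \<and> measure lebesgue Z \<le> s" using Z by blast
qed

text \<open>
An interval in the closure would contain a recurrently good $x$. At some large time $n$ the inequality
$n \rho'_n \ge c$ at $x$ persists, with $c/2$ instead of $c$, on a whole neighbourhood of $x$ by
\<open>rho'_n_near\<close>, so that this neighbourhood misses the set.
\<close>

lemma nowhere_dense_uniformly_small:
  assumes c: "0 < c" and dense: "\<And>u v. 0 \<le> u \<Longrightarrow> u < v \<Longrightarrow> v \<le> b \<Longrightarrow> \<exists>x\<in>{u<..<v}. recurrently_good c x"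
  shows "nowhere_dense {t \<in> {0<..<b}. \<forall>n\<ge>M. real n * rho'_n b f n t < c / 2}"
    (is "nowhere_dense ?N")
  unfolding nowhere_dense_def
proof (rule ccontr)
  assume "interior (closure ?N) \<noteq> {}"
  then obtain y where "y \<in> interior (closure ?N)" by blast
  then obtain e where e: "0 < e" "ball y e \<subseteq> closure ?N"
    unfolding mem_interior by blast
  have "closure ?N \<subseteq> {0..b}" by (rule closure_minimal) auto
  then have ball: "{y - e<..<y + e} \<subseteq> {0..b}" using e(2) by (auto simp: ball_eq_greaterThanLessThan)
  have "closure {y - e<..<y + e} \<subseteq> {0..b}" using ball by (rule closure_minimal) simp
  then have "0 \<le> y - e" "y + e \<le> b" using e(1) by auto
  then obtain x where x: "x \<in> {y - e<..<y + e}" "recurrently_good c x" using dense[of "y - e" "y + e"] e(1) by auto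
  have x_in: "x \<in> {0..<b}" using x(1) \<open>0 \<le> y - e\<close> \<open>y + e \<le> b\<close> by auto
  obtain n where n: "Suc M \<le> n" "c \<le> real n * rho'_n b f n x" using x(2) by (auto simp: recurrently_good_def)
  define r where "r = rho'_n b f n x"
  have r: "0 < r" using n(2) c unfolding r_def by (smt (verit) mult_nonneg_nonpos of_nat_0_le_iff)
  have "x \<in> closure ?N" using e(2) x(1) by (auto simp: ball_eq_greaterThanLessThan)
  then obtain t where t: "t \<in> ?N" "dist t x < r / 2"
    using closure_approachable[THEN iffD1, rule_format, of x ?N "r / 2"] r by auto
  have "r - \<bar>t - x\<bar> \<le> rho'_n b f n (x + (t - x))"
    unfolding r_def using t(2) n(1) r by (intro rho'_n_near[OF x_in]) (auto simp: dist_real_def r_def)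
  then have "r / 2 \<le> rho'_n b f n t" using t(2) by (simp add: dist_real_def)
  then have "real n * (r / 2) \<le> real n * rho'_n b f n t" by (intro mult_left_mono) auto
  then have "c / 2 \<le> real n * rho'_n b f n t" using n(2) by (simp add: r_def)
  moreover have "real n * rho'_n b f n t < c / 2"
    using t(1) n(1) Suc_leD by blast
  ultimately show False by simp
qed

lemma nowhere_dense_subset:
  assumes "nowhere_dense T" "S \<subseteq> T"
  shows "nowhere_dense S"
  using assms closure_mono[of S T] interior_mono[of "closure S" "closure T"] by (auto simp: nowhere_dense_def)

lemma critical_set_meager: "meager (critical_set b f)"
proof -
  obtain c where c: "0 < c" and
    dense: "\<And>u v. 0 \<le> u \<Longrightarrow> u < v \<Longrightarrow> v \<le> b \<Longrightarrow> \<exists>x\<in>{u<..<v}. recurrently_good c x"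
    using recurrently_good_dense by blast
  define N where "N M = {t \<in> {0<..<b}. \<forall>n\<ge>M. real n * rho'_n b f n t < c / 2}" for M
  have "nowhere_dense (N M)" for M
    unfolding N_def using c dense by (rule nowhere_dense_uniformly_small)
  then have nd: "nowhere_dense (critical_set b f \<inter> N M)" for M
    by (rule nowhere_dense_subset) blast
  have "critical_set b f \<subseteq> (\<Union>M. N M)"
  proof
    fix x assume x: "x \<in> critical_set b f"
    then obtain M where "\<forall>n\<ge>M. real n * rho'_n b f n x < c / 2"
      using eventually_small_if_psi_zero[of x "c / 2"] c unfolding critical_set_def by auto
    then have "x \<in> N M" using x by (simp add: N_def critical_set_def)
    then show "x \<in> (\<Union>M. N M)" by blast
  qed
  then have "critical_set b f = \<Union>(range (\<lambda>M. critical_set b f \<inter> N M))" by blast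
  then show ?thesis
    unfolding meager_def using nd by (intro exI[of _ "range (\<lambda>M. critical_set b f \<inter> N M)"]) auto
qed

end

section \<open>Interval exchange transformations as piecewise translations\<close>

text \<open>
The function $t \mapsto f(t) - t$ has derivative $0$ on the open interval, and right continuity at its
left end makes it constant on the half-open one.
\<close>

lemma iet_shift:
  assumes iet: "is_iet b f" and uv: "0 \<le> u" "v \<le> b" "{u<..<v} \<inter> discont b f = {}" and x: "x \<in> {u..<v}"
  shows "f x = f u + (x - u)"
proof (cases "x = u")
  case False
  then have ux: "u < x" "x < v" using x by auto
  have der: "(f has_real_derivative 1) (at t)" if t: "u < t" "t < v" for t
  proof -
    have "t \<in> {0..<b} - discont b f" using t uv by auto
    then have "(f has_real_derivative 1) (at t within {0..<b})" using iet by (simp add: is_iet_def)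
    moreover have "at t within {0..<b} = at t" using t uv by (intro at_within_interior) simp
    ultimately show ?thesis by (simp only:)
  qed
  have cont: "continuous (at t within {u..x}) f" if t: "t \<in> {u..x}" for t
  proof (cases "t = u")
    case True
    have "continuous (at_right u) f" using iet uv ux by (simp add: is_iet_def)
    then show ?thesis using True ux by (simp add: at_within_Icc_at_right)
  next
    case False
    then have "isCont f t" using der[of t] t ux by (intro DERIV_isCont) auto
    then show ?thesis by (rule continuous_at_imp_continuous_at_within)
  qed
  have "f x - x = f u - u"
  proof (rule DERIV_isconst_end[OF ux(1)])
    show "continuous_on {u..x} (\<lambda>t. f t - t)"
      using cont by (intro continuous_intros) (simp add: continuous_on_eq_continuous_within)
    show "((\<lambda>t. f t - t) has_real_derivative 0) (at t)" if "u < t" "t < x" for t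
      using DERIV_diff[OF der[of t] DERIV_ident] that ux by simp
  qed
  then show ?thesis by simp
qed simp

text \<open>
The inverse can only be interrupted at images of discontinuities and at $f(0)$. Let $y$ be the
preimage of $u$ and $e$ the next discontinuity of $f$ after $y$, or $b$. If the translation of $[y, e)$
ended strictly inside $[u, v)$, at $z$, then the preimage of $z$ would be a point of continuity $> 0$,
so points just below $z$ would have their preimages just below it; but they have them just below $e$. So
the preimage would be $e$ itself, which is impossible.
\<close>

lemma iet_inverse_shift:
  assumes iet: "is_iet b f" and uv: "0 \<le> u" "v \<le> b"
    and free: "{u<..<v} \<inter> f ` insert 0 (discont b f) = {}" and x: "x \<in> {u..<v}"
  shows "inv_into {0..<b} f x = inv_into {0..<b} f u + (x - u)"
proof -
  let ?g = "inv_into {0..<b} f"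
  have bij: "bij_betw f {0..<b} {0..<b}" and fin: "finite (discont b f)"
    using iet by (auto simp: is_iet_def)
  have inj: "inj_on f {0..<b}" using bij by (rule bij_betw_imp_inj_on)
  have g: "?g z \<in> {0..<b}" "f (?g z) = z" if "z \<in> {0..<b}" for z
    using bij_betw_inv_into_right[OF bij that] bij_betwE[OF bij_betw_inv_into[OF bij]] that by auto
  have u_in: "u \<in> {0..<b}" using uv x by auto
  define y where "y = ?g u"
  have y: "y \<in> {0..<b}" "f y = u" using g[OF u_in] by (auto simp: y_def)
  let ?E = "{e \<in> insert b (discont b f). y < e}"
  define e where "e = Min ?E"
  have finE: "finite ?E" using fin by simp
  have "b \<in> ?E" using y by simp
  then have "e \<in> ?E" unfolding e_def using finE by (intro Min_in) auto
  then have e: "y < e" "e \<in> insert b (discont b f)" by auto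
  have e_le: "e \<le> e'" if "e' \<in> ?E" for e' unfolding e_def using finE that by (rule Min_le)
  have eb: "e \<le> b" using e_le[OF \<open>b \<in> ?E\<close>] .
  have ye_free: "{y<..<e} \<inter> discont b f = {}" using e_le by fastforce
  have shift: "f (y + t) = u + t" if "0 \<le> t" "y + t < e" for t
    using iet_shift[OF iet _ eb ye_free, of "y + t"] y that by auto
  have "v \<le> u + (e - y)"
  proof (rule ccontr)
    assume "\<not> ?thesis"
    then have z_less: "u + (e - y) < v" by simp
    define z where "z = u + (e - y)"
    have z_in: "z \<in> {0..<b}" "z \<in> {u<..<v}" using z_less e(1) uv by (auto simp: z_def)
    define y' where "y' = ?g z"
    have y': "y' \<in> {0..<b}" "f y' = z" using g[OF z_in(1)] by (auto simp: y'_def)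
    have "y' \<notin> insert 0 (discont b f)" using free z_in(2) y'(2) by blast
    then have y'_not: "y' \<noteq> 0" "y' \<notin> discont b f" by auto
    obtain r where r: "0 < r" "\<forall>d\<in>discont b f. d \<noteq> y' \<longrightarrow> r \<le> dist y' d"
      using finite_set_avoid[OF fin] by blast
    define h where "h = Min {r, y', b - y', e - y}"
    have h: "0 < h" "h \<le> r" "h \<le> y'" "h \<le> b - y'" "h \<le> e - y"
      using r(1) y'(1) y'_not(1) e(1) by (auto simp: h_def)
    have "d \<notin> discont b f" if "y' - h < d" "d < y' + h" for d
      using r(2)[rule_format, of d] that y'_not(2) h(2) by (cases "d = y'") (auto simp: dist_real_def)
    then have "{y' - h<..<y' + h} \<inter> discont b f = {}" by auto
    then have "f y' = f (y' - h) + h"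
      using iet_shift[OF iet, of "y' - h" "y' + h" y'] h by auto
    moreover have "f (e - h) = z - h" using shift[of "e - h - y"] h by (simp add: z_def)
    ultimately have "f (y' - h) = f (e - h)" using y'(2) by simp
    then have "y' - h = e - h"
      by (rule inj_onD[OF inj]) (use h y'(1) y(1) eb e(1) in auto)
    then have "y' = e" by simp
    then show False using e(2) y'(1) y'_not(2) by auto
  qed
  then have "f (y + (x - u)) = x" "y + (x - u) \<in> {0..<b}"
    using shift[of "x - u"] x y eb by auto
  then have "?g x = y + (x - u)" using inv_into_f_f[OF inj, of "y + (x - u)"] by simp
  then show ?thesis by (simp add: y_def)
qed

lemma iet_dynamics:
  assumes iet: "is_iet b f" and aper: "aperiodic b f"
  shows "iet_dynamics b f (discont b f \<union> f ` insert 0 (discont b f))"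
proof -
  have bij: "bij_betw f {0..<b} {0..<b}" and fin: "finite (discont b f)" and b: "0 < b"
    using iet by (auto simp: is_iet_def)
  have sub: "discont b f \<subseteq> {0..<b}" by (auto simp: discont_def)
  have f_in: "f x \<in> {0..<b}" if "x \<in> {0..<b}" for x using bij_betwE[OF bij] that by blast
  show ?thesis
  proof
    show "finite (discont b f \<union> f ` insert 0 (discont b f))" using fin by simp
    show "discont b f \<union> f ` insert 0 (discont b f) \<subseteq> {0..<b}" using sub f_in b by auto
    show "f x \<in> {0..<b}" if "x \<in> {0..<b}" for x using f_in[OF that] .
    show "inv_into {0..<b} f x \<in> {0..<b}" if "x \<in> {0..<b}" for x
      using bij_betwE[OF bij_betw_inv_into[OF bij]] that by blast
    show "inv_into {0..<b} f (f x) = x" if "x \<in> {0..<b}" for x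
      by (rule bij_betw_inv_into_left[OF bij that])
    show "f (inv_into {0..<b} f x) = x" if "x \<in> {0..<b}" for x
      by (rule bij_betw_inv_into_right[OF bij that])
    show "(f ^^ n) x \<noteq> x" if "x \<in> {0..<b}" "1 \<le> n" for x n
      using aper that by (simp add: aperiodic_def)
    fix u v x :: real
    assume uv: "0 \<le> u" "v \<le> b"
    assume x: "x \<in> {u..<v}"
    {
      assume "{u<..<v} \<inter> discont b f = {}"
      then show "f x = f u + (x - u)" by (rule iet_shift[OF iet uv _ x])
    }
    assume free: "{u<..<v} \<inter> (discont b f \<union> f ` insert 0 (discont b f)) = {}"
    show "f x = f u + (x - u)" using free by (intro iet_shift[OF iet uv _ x]) auto
    show "inv_into {0..<b} f x = inv_into {0..<b} f u + (x - u)"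
      using free by (intro iet_inverse_shift[OF iet uv _ x]) auto
  qed (use b in auto)
qed

theorem theorem3:
  fixes b :: real and f :: "real \<Rightarrow> real"
  assumes "is_iet b f" and "aperiodic b f"
  shows "meager (critical_set b f) \<and> critical_set b f \<in> null_sets lebesgue"
proof -
  interpret iet_dynamics b f "discont b f \<union> f ` insert 0 (discont b f)"
    using assms by (rule iet_dynamics)
  show ?thesis using critical_set_meager critical_set_null by blast
qed

end
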